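(* Let $X$ and $Y$ be finite dimensional complex Hilbert spaces and let $\mathcal{G}=(G,\varphi,\theta,\tau)$ be a $\Gamma$-symmetric framework for $X$ and $Y$, where $G=(V,E)$ has a finite or a countably infinite vertex set, $\Gamma$ is a discrete abelian group, $\theta$ acts freely on the vertices and edges of $G$, and the sets $V_0$ and $E_0$ of vertex orbits and edge orbits are finite. Then $C(G,\varphi)\in B(\ell^2(V,X),\ell^2(E,Y))$ and \[C(G,\varphi)=S_E^{-1}\circ F_{Y^{E_0}}^{-1}\circ M_\Phi\circ F_{X^{V_0}}\circ T_{\tilde\tau}\circ S_V\] for some $\Phi\in L^\infty(\hat\Gamma,B(X^{V_0},Y^{E_0}))$.
   Context: Frameworks. A framework for $X$ and $Y$ is a pair $(G,\varphi)$ with $G=(V,E)$ a simple undirected graph and $\varphi=(\varphi_{v,w})_{v,w\in V}$ a family of linear maps $\varphi_{v,w}:X\to Y$ with $\varphi_{v,w}=0$ if $vw\notin E$ and $\varphi_{v,w}=-\varphi_{w,v}$ if $vw\in E$. Its coboundary matrix $C(G,\varphi)$ has rows indexed by $E$, columns indexed by $V$; in row $vw$ the $v$-entry is $\varphi_{v,w}$, the $w$-entry is $\varphi_{w,v}$, and other entries are $0$. It defines the linear map $C(G,\varphi):X^V\to Y^E$, $(x_v)_{v\in V}\mapsto(\varphi_{v,w}(x_v-x_w))_{vw\in E}$. Symmetry. $\Gamma$ is written additively with identity $0$. $\theta:\Gamma\to\mathrm{Aut}(G)$ is a homomorphism; write $\gamma v=\theta(\gamma)v$ and $\gamma e=(\gamma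 v)(\gamma w)$ for $e=vw$. Acting freely means $\gamma v\ne v$ and $\gamma e\neq e$ for all $\gamma\ne0$, $v\in V$, $e\in E$. $[v]$, $[e]$ denote orbits; $V_0$, $E_0$ the sets of vertex and edge orbits. $\tau:\Gamma\to\mathrm{Isom}(X)$ is a homomorphism into the group of affine isometries of $X$, with $d\tau(\gamma)$ the linear part of $\tau(\gamma)$ (a linear isometry of $X$). $(G,\varphi,\theta,\tau)$ is a $\Gamma$-symmetric framework if $\varphi_{\gamma v,\gamma w}=\varphi_{v,w}\circ d\tau(-\gamma)$ for all $\gamma\in\Gamma$, $v,w\in V$. Gain graph. Choose a representative $\tilde v\in[v]$ for each $[v]\in V_0$. The quotient multigraph has vertex set $V_0$ and edge set $E_0$, $[e]$ joining $[v]$ and $[w]$ if edges in $[e]$ join a vertex of $[v]$ to one of $[w]$; fix an orientation $[e]=([v],[w])$ of each edge. The gain of $[e]=([v],[w])$ is the $\gamma\in\Gamma$ with $\tilde v(\gamma\tilde w)\in[e]$ (for a loop, $[v]=[w]$, this determines $\gamma$ up to sign and one choice is fixed). Put $\tilde e=\tilde v(\gamma\tilde w)\in E$. Every vertex is uniquely $\gamma\tilde v$ and every edge uniquely $\gamma\tilde e$. Operators. $S_V:\ell^2(V,X)\to\ell^2(\Gamma,X^{V_0})$, $S_V(z)_\gamma=(z_{\gamma\tilde v})_{[v]\in V_0}$, and $S_E:\ell^2(E,Y)\to\ell^2(\Gamma,Y^{E_0})$, $S_E(z)_\gamma=(z_{\gamma\tilde e})_{[e]\in E_0}$, are unitary.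 $\tilde\tau:\Gamma\to U(X^{V_0})$ is $\tilde\tau(\gamma)(x_{[v]})_{[v]}=(d\tau(\gamma)x_{[v]})_{[v]}$, and $(T_{\tilde\tau}f)(\gamma)=\tilde\tau(-\gamma)f(\gamma)$ on $\ell^2(\Gamma,X^{V_0})$. $\hat\Gamma$ is the (compact) dual group with Haar probability measure; for a finite dimensional Hilbert space $H$, $F_H:\ell^2(\Gamma,H)\to L^2(\hat\Gamma,H)$ is the unitary Fourier transform, $\hat f(\chi)=\sum_{\gamma}\overline{\chi(\gamma)}f(\gamma)$ for $f\in\ell^1(\Gamma,H)$. $M_\Phi:L^2(\hat\Gamma,X^{V_0})\to L^2(\hat\Gamma,Y^{E_0})$ is $(M_\Phi f)(\chi)=\Phi(\chi)f(\chi)$ a.e. *)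

theory Defs
  imports "HOL-Probability.Probability"
begin

section \<open>Finite-dimensional complex Hilbert spaces\<close>

class complex_vector = real_vector +
  fixes scaleC :: "complex \<Rightarrow> 'a \<Rightarrow> 'a"  (infixr "*\<^sub>C" 75)
  assumes scaleC_add_right: "c *\<^sub>C (x + y) = c *\<^sub>C x + c *\<^sub>C y"
    and scaleC_add_left: "(c + d) *\<^sub>C x = c *\<^sub>C x + d *\<^sub>C x"
    and scaleC_scaleC: "c *\<^sub>C (d *\<^sub>C x) = (c * d) *\<^sub>C x"
    and scaleR_scaleC: "r *\<^sub>R x = complex_of_real r *\<^sub>C x"

text \<open>
  The topology and the norm are those of the underlying real inner product space, whose inner
  product is the real part of the complex one. Unlike for the class of Euclidean spaces,
  the zero space is allowed; completeness is automatic in finite dimension.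
\<close>

class fd_complex_hilbert = complex_vector + real_inner +
  fixes cinner :: "'a \<Rightarrow> 'a \<Rightarrow> complex"
  assumes cinner_add_left: "cinner (x + y) z = cinner x z + cinner y z"
    and cinner_scaleC_left: "cinner (c *\<^sub>C x) y = c * cinner x y"
    and cinner_commute: "cinner y x = cnj (cinner x y)"
    and inner_Re_cinner: "inner x y = Re (cinner x y)"
    and finite_spanning: "\<exists>B. finite B \<and> (\<forall>x. \<exists>c. x = (\<Sum>b\<in>B. c b *\<^sub>C b))"

instantiation complex :: fd_complex_hilbert
begin

definition scaleC_complex :: "complex \<Rightarrow> complex \<Rightarrow> complex" where
  "scaleC_complex c x = c * x"

definition cinner_complex :: "complex \<Rightarrow> complex \<Rightarrow> complex" where
  "cinner_complex x y = x * cnj y"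

instance
proof
  fix c d x y z :: complex and r :: real
  show "c *\<^sub>C (x + y) = c *\<^sub>C x + c *\<^sub>C y" "(c + d) *\<^sub>C x = c *\<^sub>C x + d *\<^sub>C x"
    "c *\<^sub>C (d *\<^sub>C x) = (c * d) *\<^sub>C x" "r *\<^sub>R x = complex_of_real r *\<^sub>C x"
    by (simp_all add: scaleC_complex_def algebra_simps scaleR_conv_of_real)
  show "cinner (x + y) z = cinner x z + cinner y z" "cinner (c *\<^sub>C x) y = c * cinner x y"
    "cinner y x = cnj (cinner x y)" "inner x y = Re (cinner x y)"
    by (simp_all add: scaleC_complex_def cinner_complex_def algebra_simps inner_complex_def)
  show "\<exists>B. finite B \<and> (\<forall>x::complex. \<exists>c. x = (\<Sum>b\<in>B. c b *\<^sub>C b))"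
    by (rule exI[of _ "{1}"]) (auto simp: scaleC_complex_def)
qed

end

definition clinear :: "('a::complex_vector \<Rightarrow> 'b::complex_vector) \<Rightarrow> bool" where
  "clinear f \<longleftrightarrow> (\<forall>x y. f (x + y) = f x + f y) \<and> (\<forall>c x. f (c *\<^sub>C x) = c *\<^sub>C f x)"

definition linear_part :: "('a::complex_vector \<Rightarrow> 'a) \<Rightarrow> 'a \<Rightarrow> 'a" where
  "linear_part T x = T x - T 0"

text \<open>Affine is meant over the complex numbers, so linear parts are unitary.\<close>

definition affine_isometries :: "('a::fd_complex_hilbert \<Rightarrow> 'a) set" where
  "affine_isometries =
     {T. clinear (linear_part T) \<and> (\<forall>x y. dist (T x) (T y) = dist x y) \<and> bij T}"


section \<open>Function spaces\<close>

text \<open>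
  Functions on a subset \<open>I\<close> of a type are represented by total functions vanishing off \<open>I\<close>.
  For finite \<open>I\<close>, \<open>pow_space I\<close> with norm \<open>pow_norm I\<close> is the Hilbert space \<open>Z\<^sup>I\<close>, the direct sum
  of copies of \<open>Z\<close>.
\<close>

definition pow_space :: "'i set \<Rightarrow> ('i \<Rightarrow> 'z::fd_complex_hilbert) set" where
  "pow_space I = {x. \<forall>i. i \<notin> I \<longrightarrow> x i = 0}"

definition pow_norm :: "'i set \<Rightarrow> ('i \<Rightarrow> 'z::fd_complex_hilbert) \<Rightarrow> real" where
  "pow_norm I x = L2_set (\<lambda>i. norm (x i)) I"

definition pow_linear ::
  "'i set \<Rightarrow> 'j set \<Rightarrow> (('i \<Rightarrow> 'x::fd_complex_hilbert) \<Rightarrow> ('j \<Rightarrow> 'y::fd_complex_hilbert)) \<Rightarrow> bool" where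
  "pow_linear I J A \<longleftrightarrow>
     (\<forall>x\<in>pow_space I. A x \<in> pow_space J) \<and>
     (\<forall>x\<in>pow_space I. \<forall>y\<in>pow_space I. A (\<lambda>i. x i + y i) = (\<lambda>j. A x j + A y j)) \<and>
     (\<forall>c. \<forall>x\<in>pow_space I. A (\<lambda>i. c *\<^sub>C x i) = (\<lambda>j. c *\<^sub>C A x j))"

definition l2 :: "'i set \<Rightarrow> ('i \<Rightarrow> 'z::fd_complex_hilbert) set" where
  "l2 I = {z. (\<forall>i. i \<notin> I \<longrightarrow> z i = 0) \<and> (\<lambda>i. (norm (z i))\<^sup>2) summable_on I}"

definition l2_norm :: "'i set \<Rightarrow> ('i \<Rightarrow> 'z::fd_complex_hilbert) \<Rightarrow> real" where
  "l2_norm I z = sqrt (\<Sum>\<^sub>\<infinity>i\<in>I. (norm (z i))\<^sup>2)"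

definition bounded_l2_operator ::
  "'i set \<Rightarrow> 'j set \<Rightarrow> (('i \<Rightarrow> 'x::fd_complex_hilbert) \<Rightarrow> ('j \<Rightarrow> 'y::fd_complex_hilbert)) \<Rightarrow> bool" where
  "bounded_l2_operator I J A \<longleftrightarrow>
     (\<forall>z\<in>l2 I. A z \<in> l2 J) \<and>
     (\<forall>z\<in>l2 I. \<forall>z'\<in>l2 I. A (\<lambda>i. z i + z' i) = (\<lambda>j. A z j + A z' j)) \<and>
     (\<forall>c. \<forall>z\<in>l2 I. A (\<lambda>i. c *\<^sub>C z i) = (\<lambda>j. c *\<^sub>C A z j)) \<and>
     (\<exists>K. \<forall>z\<in>l2 I. l2_norm J (A z) \<le> K * l2_norm I z)"

text \<open>The space \<open>\<ell>\<^sup>2(\<Gamma>, Z\<^sup>I)\<close>, where \<open>\<Gamma>\<close> is the whole type.\<close>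

definition l2_group :: "'i set \<Rightarrow> ('g \<Rightarrow> 'i \<Rightarrow> 'z::fd_complex_hilbert) set" where
  "l2_group I = {f. (\<forall>\<gamma>. f \<gamma> \<in> pow_space I) \<and> (\<lambda>\<gamma>. (pow_norm I (f \<gamma>))\<^sup>2) summable_on UNIV}"


section \<open>The dual group and the Fourier transform\<close>

text \<open>
  The group is discrete, so characters are arbitrary homomorphisms into the circle; the dual
  carries the topology of pointwise convergence, i.e. the subspace topology of the product
  topology that the library puts on function types.
\<close>

definition dual_group :: "('g::ab_group_add \<Rightarrow> complex) set" where
  "dual_group = {\<xi>. (\<forall>a b. \<xi> (a + b) = \<xi> a * \<xi> b) \<and> (\<forall>a. cmod (\<xi> a) = 1)}"

text \<open>
  Haar probability measure: the translation-invariant Radon probability measure on the Borel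
  sets of the dual. Inner regularity is automatic when the group is countable.
\<close>

definition haar_probability :: "('g::ab_group_add \<Rightarrow> complex) measure \<Rightarrow> bool" where
  "haar_probability \<mu> \<longleftrightarrow>
     sets \<mu> = sets (restrict_space borel dual_group) \<and>
     prob_space \<mu> \<and>
     (\<forall>\<psi>\<in>dual_group. \<forall>A\<in>sets \<mu>. emeasure \<mu> ((\<lambda>\<xi> \<gamma>. \<psi> \<gamma> * \<xi> \<gamma>) ` A) = emeasure \<mu> A) \<and>
     (\<forall>A\<in>sets \<mu>. emeasure \<mu> A = (SUP K\<in>{K. compact K \<and> K \<subseteq> A}. emeasure \<mu> K))"

text \<open>
  Square-integrable \<open>Z\<^sup>I\<close>-valued functions for finite \<open>I\<close>. As \<open>Z\<^sup>I\<close> is a finite product of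
  separable metric spaces, Borel measurability is measurability of the coordinates.
\<close>

definition L2_fun :: "'c measure \<Rightarrow> 'i set \<Rightarrow> ('c \<Rightarrow> 'i \<Rightarrow> 'z::fd_complex_hilbert) set" where
  "L2_fun \<mu> I =
     {f. (\<forall>\<xi>\<in>space \<mu>. f \<xi> \<in> pow_space I) \<and>
         (\<forall>i\<in>I. (\<lambda>\<xi>. f \<xi> i) \<in> borel_measurable \<mu>) \<and>
         integrable \<mu> (\<lambda>\<xi>. (pow_norm I (f \<xi>))\<^sup>2)}"

definition L2_rel ::
  "'c measure \<Rightarrow> 'i set \<Rightarrow> (('c \<Rightarrow> 'i \<Rightarrow> 'z::fd_complex_hilbert) \<times> ('c \<Rightarrow> 'i \<Rightarrow> 'z)) set" where
  "L2_rel \<mu> I = {(f, g). f \<in> L2_fun \<mu> I \<and> g \<in> L2_fun \<mu> I \<and> (AE \<xi> in \<mu>. f \<xi> = g \<xi>)}"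

definition L2_norm :: "'c measure \<Rightarrow> 'i set \<Rightarrow> ('c \<Rightarrow> 'i \<Rightarrow> 'z::fd_complex_hilbert) \<Rightarrow> real" where
  "L2_norm \<mu> I f = sqrt (\<integral>\<xi>. (pow_norm I (f \<xi>))\<^sup>2 \<partial>\<mu>)"

definition fourier_l1 ::
  "('g::ab_group_add \<Rightarrow> 'i \<Rightarrow> 'z::fd_complex_hilbert) \<Rightarrow> ('g \<Rightarrow> complex) \<Rightarrow> 'i \<Rightarrow> 'z" where
  "fourier_l1 f \<xi> = (\<lambda>i. \<Sum>\<^sub>\<infinity>\<gamma>. cnj (\<xi> \<gamma>) *\<^sub>C f \<gamma> i)"

text \<open>
  The continuous extension of the \<open>\<ell>\<^sup>1\<close>-formula to \<open>\<ell>\<^sup>2(\<Gamma>, Z\<^sup>I)\<close>: the truncations of \<open>f\<close> to finite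
  subsets converge to \<open>f\<close> in \<open>\<ell>\<^sup>2\<close>, and the transform of \<open>f\<close> is the \<open>L\<^sup>2\<close>-limit of their transforms.
  Its value is an almost-everywhere class, that is, an element of \<open>L2_fun \<mu> I // L2_rel \<mu> I\<close>.
\<close>

definition fourier ::
  "('g::ab_group_add \<Rightarrow> complex) measure \<Rightarrow> 'i set \<Rightarrow> ('g \<Rightarrow> 'i \<Rightarrow> 'z::fd_complex_hilbert) \<Rightarrow>
   (('g \<Rightarrow> complex) \<Rightarrow> 'i \<Rightarrow> 'z) set" where
  "fourier \<mu> I f =
     {g \<in> L2_fun \<mu> I.
        ((\<lambda>A. L2_norm \<mu> I
            (\<lambda>\<xi> i. g \<xi> i - fourier_l1 (\<lambda>\<gamma>. if \<gamma> \<in> A then f \<gamma> else (\<lambda>_. 0)) \<xi> i))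
          \<longlongrightarrow> 0) (finite_subsets_at_top UNIV)}"

text \<open>
  Representatives of elements of \<open>L\<^sup>\<infinity>(\<mu>, B(X\<^sup>I, Y\<^sup>J))\<close> for finite \<open>I\<close> and \<open>J\<close>. The operator space is
  finite dimensional, so measurability for the norm topology is measurability of all
  evaluations, and all linear maps are bounded; the last clause says that the operator norm is
  essentially bounded.
\<close>

definition Linf_op ::
  "'c measure \<Rightarrow> 'i set \<Rightarrow> 'j set \<Rightarrow>
   ('c \<Rightarrow> ('i \<Rightarrow> 'x::fd_complex_hilbert) \<Rightarrow> ('j \<Rightarrow> 'y::fd_complex_hilbert)) set" where
  "Linf_op \<mu> I J =
     {\<Phi>. (\<forall>\<xi>\<in>space \<mu>. pow_linear I J (\<Phi> \<xi>)) \<and>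
         (\<forall>x\<in>pow_space I. \<forall>j\<in>J. (\<lambda>\<xi>. \<Phi> \<xi> x j) \<in> borel_measurable \<mu>) \<and>
         (\<exists>K. AE \<xi> in \<mu>. \<forall>x\<in>pow_space I. pow_norm J (\<Phi> \<xi> x) \<le> K * pow_norm I x)}"

definition mult_op ::
  "'c measure \<Rightarrow> 'j set \<Rightarrow>
   ('c \<Rightarrow> ('i \<Rightarrow> 'x::fd_complex_hilbert) \<Rightarrow> ('j \<Rightarrow> 'y::fd_complex_hilbert)) \<Rightarrow>
   ('c \<Rightarrow> 'i \<Rightarrow> 'x) set \<Rightarrow> ('c \<Rightarrow> 'j \<Rightarrow> 'y) set" where
  "mult_op \<mu> J \<Phi> F = (\<Union>f\<in>F. L2_rel \<mu> J `` {\<lambda>\<xi>. \<Phi> \<xi> (f \<xi>)})"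


section \<open>Frameworks and their symmetries\<close>

definition simple_graph :: "'v set \<Rightarrow> 'v set set \<Rightarrow> bool" where
  "simple_graph V E \<longleftrightarrow> (\<forall>e\<in>E. \<exists>v\<in>V. \<exists>w\<in>V. v \<noteq> w \<and> e = {v, w})"

definition framework ::
  "'v set \<Rightarrow> 'v set set \<Rightarrow> ('v \<Rightarrow> 'v \<Rightarrow> 'x::fd_complex_hilbert \<Rightarrow> 'y::fd_complex_hilbert) \<Rightarrow> bool" where
  "framework V E \<phi> \<longleftrightarrow>
     simple_graph V E \<and>
     (\<forall>v\<in>V. \<forall>w\<in>V. clinear (\<phi> v w) \<and>
        ({v, w} \<notin> E \<longrightarrow> \<phi> v w = (\<lambda>_. 0)) \<and>
        ({v, w} \<in> E \<longrightarrow> \<phi> v w = (\<lambda>x. - \<phi> w v x)))"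

definition coboundary_entry ::
  "('v \<Rightarrow> 'v \<Rightarrow> 'x::fd_complex_hilbert \<Rightarrow> 'y::fd_complex_hilbert) \<Rightarrow> 'v set \<Rightarrow> 'v \<Rightarrow> 'x \<Rightarrow> 'y" where
  "coboundary_entry \<phi> e v = (if v \<in> e then \<phi> v (THE w. e = {v, w}) else (\<lambda>_. 0))"

text \<open>Row \<open>e\<close> of the matrix vanishes outside the two columns belonging to the ends of \<open>e\<close>.\<close>

definition coboundary ::
  "'v set set \<Rightarrow> ('v \<Rightarrow> 'v \<Rightarrow> 'x::fd_complex_hilbert \<Rightarrow> 'y::fd_complex_hilbert) \<Rightarrow>
   ('v \<Rightarrow> 'x) \<Rightarrow> ('v set \<Rightarrow> 'y)" where
  "coboundary E \<phi> x = (\<lambda>e. if e \<in> E then (\<Sum>v\<in>e. coboundary_entry \<phi> e v (x v)) else 0)"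

lemma coboundary_edge:
  assumes "framework V E \<phi>" "v \<in> V" "w \<in> V" "{v, w} \<in> E"
  shows "coboundary E \<phi> x {v, w} = \<phi> v w (x v - x w)"
proof -
  have sg: "simple_graph V E"
    using assms(1) unfolding framework_def by (rule conjunct1)
  have ne: "v \<noteq> w"
    using bspec[OF sg[unfolded simple_graph_def] assms(4)] by (auto simp: doubleton_eq_iff)
  have E': "{w, v} \<in> E" using assms(4) by (simp only: insert_commute)
  have fw: "clinear (\<phi> a b)" "{a, b} \<in> E \<Longrightarrow> \<phi> a b = (\<lambda>x. - \<phi> b a x)"
    if "a \<in> V" "b \<in> V" for a b
    using bspec[OF bspec[OF conjunct2[OF assms(1)[unfolded framework_def]] that(1)] that(2)]
    by (elim conjE; iprover)+
  have anti: "\<phi> w v = (\<lambda>x. - \<phi> v w x)"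
    by (rule fw(2)[OF assms(3,2) E'])
  have lin: "clinear (\<phi> v w)"
    by (rule fw(1)[OF assms(2,3)])
  have the: "(THE u. {v, w} = {v, u}) = w" "(THE u. {v, w} = {w, u}) = v"
    using ne by (simp_all add: doubleton_eq_iff)
  have "\<phi> v w (x v - x w + x w) = \<phi> v w (x v - x w) + \<phi> v w (x w)"
    using lin unfolding clinear_def by blast
  then have diff: "\<phi> v w (x v) = \<phi> v w (x v - x w) + \<phi> v w (x w)" by simp
  have "coboundary E \<phi> x {v, w} = \<phi> v w (x v) + \<phi> w v (x w)"
    using ne assms(4) by (simp add: coboundary_def coboundary_entry_def the)
  also have "\<dots> = \<phi> v w (x v - x w)"
    by (simp only: anti diff add.assoc add.right_inverse add_0_right)
  finally show ?thesis .
qed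

definition graph_automorphisms :: "'v set \<Rightarrow> 'v set set \<Rightarrow> ('v \<Rightarrow> 'v) set" where
  "graph_automorphisms V E =
     {f. bij_betw f V V \<and> (\<forall>v\<in>V. \<forall>w\<in>V. {f v, f w} \<in> E \<longleftrightarrow> {v, w} \<in> E)}"

definition symmetric_framework ::
  "'v set \<Rightarrow> 'v set set \<Rightarrow> ('v \<Rightarrow> 'v \<Rightarrow> 'x::fd_complex_hilbert \<Rightarrow> 'y::fd_complex_hilbert) \<Rightarrow>
   ('g::ab_group_add \<Rightarrow> 'v \<Rightarrow> 'v) \<Rightarrow> ('g \<Rightarrow> 'x \<Rightarrow> 'x) \<Rightarrow> bool" where
  "symmetric_framework V E \<phi> \<theta> \<tau> \<longleftrightarrow>
     framework V E \<phi> \<and>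
     (\<forall>\<gamma>. \<theta> \<gamma> \<in> graph_automorphisms V E) \<and>
     (\<forall>\<gamma> \<delta>. \<forall>v\<in>V. \<theta> (\<gamma> + \<delta>) v = \<theta> \<gamma> (\<theta> \<delta> v)) \<and>
     (\<forall>\<gamma>. \<tau> \<gamma> \<in> affine_isometries) \<and>
     (\<forall>\<gamma> \<delta>. \<tau> (\<gamma> + \<delta>) = \<tau> \<gamma> \<circ> \<tau> \<delta>) \<and>
     (\<forall>\<gamma>. \<forall>v\<in>V. \<forall>w\<in>V. \<phi> (\<theta> \<gamma> v) (\<theta> \<gamma> w) = \<phi> v w \<circ> linear_part (\<tau> (- \<gamma>)))"

definition acts_freely ::
  "'v set \<Rightarrow> 'v set set \<Rightarrow> ('g::ab_group_add \<Rightarrow> 'v \<Rightarrow> 'v) \<Rightarrow> bool" where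
  "acts_freely V E \<theta> \<longleftrightarrow>
     (\<forall>\<gamma>. \<gamma> \<noteq> 0 \<longrightarrow> (\<forall>v\<in>V. \<theta> \<gamma> v \<noteq> v) \<and> (\<forall>e\<in>E. \<theta> \<gamma> ` e \<noteq> e))"

definition vertex_orbits :: "'v set \<Rightarrow> ('g \<Rightarrow> 'v \<Rightarrow> 'v) \<Rightarrow> 'v set set" where
  "vertex_orbits V \<theta> = (\<lambda>v. range (\<lambda>\<gamma>. \<theta> \<gamma> v)) ` V"

definition edge_orbits :: "'v set set \<Rightarrow> ('g \<Rightarrow> 'v \<Rightarrow> 'v) \<Rightarrow> 'v set set set" where
  "edge_orbits E \<theta> = (\<lambda>e. range (\<lambda>\<gamma>. \<theta> \<gamma> ` e)) ` E"


section \<open>Gain graphs and the operators of the factorisation\<close>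

definition edge_rep ::
  "('g \<Rightarrow> 'v \<Rightarrow> 'v) \<Rightarrow> ('v set \<Rightarrow> 'v) \<Rightarrow> ('v set set \<Rightarrow> 'v set) \<Rightarrow> ('v set set \<Rightarrow> 'v set) \<Rightarrow>
   ('v set set \<Rightarrow> 'g) \<Rightarrow> 'v set set \<Rightarrow> 'v set" where
  "edge_rep \<theta> rep src tgt gain a = {rep (src a), \<theta> (gain a) (rep (tgt a))}"

text \<open>
  Choices of vertex representatives, of an orientation \<open>(src a, tgt a)\<close> of each edge \<open>a\<close> of the
  quotient multigraph, and of its gain. The gain is determined by the other choices, except that
  for a loop (\<open>src a = tgt a\<close>) it is determined up to sign and either choice is admitted.
\<close>

definition gain_graph ::
  "'v set \<Rightarrow> 'v set set \<Rightarrow> ('g \<Rightarrow> 'v \<Rightarrow> 'v) \<Rightarrow> ('v set \<Rightarrow> 'v) \<Rightarrow>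
   ('v set set \<Rightarrow> 'v set) \<Rightarrow> ('v set set \<Rightarrow> 'v set) \<Rightarrow> ('v set set \<Rightarrow> 'g) \<Rightarrow> bool" where
  "gain_graph V E \<theta> rep src tgt gain \<longleftrightarrow>
     (\<forall>p\<in>vertex_orbits V \<theta>. rep p \<in> p) \<and>
     (\<forall>a\<in>edge_orbits E \<theta>.
        src a \<in> vertex_orbits V \<theta> \<and> tgt a \<in> vertex_orbits V \<theta> \<and>
        edge_rep \<theta> rep src tgt gain a \<in> a)"

definition S_V ::
  "'v set \<Rightarrow> ('g \<Rightarrow> 'v \<Rightarrow> 'v) \<Rightarrow> ('v set \<Rightarrow> 'v) \<Rightarrow>
   ('v \<Rightarrow> 'x::fd_complex_hilbert) \<Rightarrow> ('g \<Rightarrow> 'v set \<Rightarrow> 'x)" where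
  "S_V V \<theta> rep z = (\<lambda>\<gamma> p. if p \<in> vertex_orbits V \<theta> then z (\<theta> \<gamma> (rep p)) else 0)"

definition S_E ::
  "'v set set \<Rightarrow> ('g \<Rightarrow> 'v \<Rightarrow> 'v) \<Rightarrow> ('v set \<Rightarrow> 'v) \<Rightarrow> ('v set set \<Rightarrow> 'v set) \<Rightarrow>
   ('v set set \<Rightarrow> 'v set) \<Rightarrow> ('v set set \<Rightarrow> 'g) \<Rightarrow>
   ('v set \<Rightarrow> 'y::fd_complex_hilbert) \<Rightarrow> ('g \<Rightarrow> 'v set set \<Rightarrow> 'y)" where
  "S_E E \<theta> rep src tgt gain z =
     (\<lambda>\<gamma> a. if a \<in> edge_orbits E \<theta> then z (\<theta> \<gamma> ` edge_rep \<theta> rep src tgt gain a) else 0)"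

definition tau_tilde ::
  "('g \<Rightarrow> 'x::fd_complex_hilbert \<Rightarrow> 'x) \<Rightarrow> 'g \<Rightarrow> ('i \<Rightarrow> 'x) \<Rightarrow> ('i \<Rightarrow> 'x)" where
  "tau_tilde \<tau> \<gamma> x = (\<lambda>i. linear_part (\<tau> \<gamma>) (x i))"

definition T_op ::
  "('g::ab_group_add \<Rightarrow> 'x::fd_complex_hilbert \<Rightarrow> 'x) \<Rightarrow> ('g \<Rightarrow> 'i \<Rightarrow> 'x) \<Rightarrow> ('g \<Rightarrow> 'i \<Rightarrow> 'x)" where
  "T_op \<tau> f = (\<lambda>\<gamma>. tau_tilde \<tau> (- \<gamma>) (f \<gamma>))"

end

theory Submission imports Defs
begin

text \<open>
  Over an orbit of edges, the coboundary operator is a finite combination of translations of \<open>\<Gamma>\<close>.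
  For the edge orbit \<open>a\<close> with representative \<open>{s, \<theta> g t}\<close>, where \<open>g\<close> is its gain, the entry at the
  translate by \<open>\<gamma>\<close> is, by equivariance of \<open>\<phi>\<close>, the image under \<open>\<phi>\<^sub>a = \<phi> s (\<theta> g t)\<close> of
  \<open>d\<tau>(-\<gamma>)(z(\<gamma> s) - z((\<gamma> + g) t))\<close>. With \<open>f = T S\<^sub>V z\<close>, that is \<open>f \<gamma> p = d\<tau>(-\<gamma>)(z(\<gamma> (rep p)))\<close>, this
  reads \<open>\<phi>\<^sub>a (f \<gamma> (src a)) - \<phi>\<^sub>a (d\<tau>(g) (f (\<gamma> + g) (tgt a)))\<close> (\<open>coboundary_convolution\<close>): the twist
  by \<open>d\<tau>(-\<gamma>)\<close> is exactly what makes the coefficients independent of \<open>\<gamma>\<close>. The Fourier transform turns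
  the shift \<open>f \<mapsto> (\<lambda>\<gamma>. f (\<gamma> + g))\<close> into multiplication by \<open>\<xi> g\<close>, so the operator becomes multiplication by

    \<open>\<Phi>(\<xi>) x a = \<phi>\<^sub>a (x (src a)) - \<xi> g \<cdot> \<phi>\<^sub>a (d\<tau>(g) (x (tgt a)))\<close>  (\<open>symbol\<close>).

  Boundedness is an estimate over finite sums: there are finitely many maps \<open>\<phi>\<^sub>a\<close>, the maps \<open>d\<tau>\<close>
  are isometries, and the translates of a representative vertex are pairwise distinct
  (\<open>coboundary_translates_bound\<close>).

  The analytic content is that the Fourier transform of every square-summable function exists
  and determines that function, so that the inverses of the factorisation take the right values.
  Both rest on Parseval's identity for trigonometric sums, hence on the orthogonality of the
  evaluations \<open>\<xi> \<mapsto> \<xi> \<gamma>\<close> under Haar measure (\<open>integral_character\<close>). Translating by a character \<open>\<psi>\<close>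
  multiplies the integral of \<open>\<xi> \<gamma>\<close> by \<open>\<psi> \<gamma>\<close>, so for \<open>\<gamma> \<noteq> 0\<close> it vanishes once some character is
  nontrivial at \<open>\<gamma>\<close> (\<open>characters_separate_points\<close>, by Zorn's lemma). Existence of the transform is
  the Riesz-Fischer theorem (\<open>has_fourier_exists\<close>). The product \<open>\<Phi> f\<close> is recognised directly as
  the transform of \<open>S\<^sub>E\<close> applied to the coboundary (\<open>symbol_mult_fourier\<close>), because the limit of
  truncations defining the transform is compatible with linear maps and with translations.
\<close>

section \<open>Linear algebra and topology of the coefficient spaces\<close>

lemma scaleC_one: "1 *\<^sub>C (x::'a::complex_vector) = x"
  using scaleR_scaleC[of 1 x] by simp

lemma scaleC_zero_left: "0 *\<^sub>C (x::'a::complex_vector) = 0"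
  using scaleR_scaleC[of 0 x] by simp

lemma scaleC_zero_right: "c *\<^sub>C (0::'a::complex_vector) = 0"
  using scaleC_add_right[of c 0 0] by simp

lemma scaleC_diff_right: "c *\<^sub>C (x - y::'a::complex_vector) = c *\<^sub>C x - c *\<^sub>C y"
  using scaleC_add_right[of c "x - y" y] by simp

lemma scaleC_diff_left: "(c - d) *\<^sub>C (x::'a::complex_vector) = c *\<^sub>C x - d *\<^sub>C x"
  using scaleC_add_left[of "c - d" d x] by simp

lemma scaleC_sum_right: "c *\<^sub>C (\<Sum>i\<in>A. f i) = (\<Sum>i\<in>A. c *\<^sub>C (f i :: 'a::complex_vector))"
  by (induction A rule: infinite_finite_induct) (simp_all add: scaleC_zero_right scaleC_add_right)

lemma scaleC_sum_left: "(\<Sum>i\<in>A. c i) *\<^sub>C (x::'a::complex_vector) = (\<Sum>i\<in>A. c i *\<^sub>C x)"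
  by (induction A rule: infinite_finite_induct) (simp_all add: scaleC_zero_left scaleC_add_left)

lemma cinner_zero_left: "cinner 0 (y::'a::fd_complex_hilbert) = 0"
  using cinner_add_left[of 0 0 y] by simp

lemma cinner_sum_left:
  "cinner (\<Sum>i\<in>A. f i) (y::'a::fd_complex_hilbert) = (\<Sum>i\<in>A. cinner (f i) y)"
  by (induction A rule: infinite_finite_induct) (simp_all add: cinner_zero_left cinner_add_left)

lemma cinner_add_right: "cinner (x::'a::fd_complex_hilbert) (y + z) = cinner x y + cinner x z"
  by (metis cinner_add_left cinner_commute complex_cnj_add)

lemma cinner_scaleC_right: "cinner (x::'a::fd_complex_hilbert) (c *\<^sub>C y) = cnj c * cinner x y"
  by (metis cinner_scaleC_left cinner_commute complex_cnj_mult)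

lemma cinner_zero_right: "cinner (x::'a::fd_complex_hilbert) 0 = 0"
  using cinner_add_right[of x 0 0] by simp

lemma cinner_sum_right:
  "cinner (x::'a::fd_complex_hilbert) (\<Sum>i\<in>A. f i) = (\<Sum>i\<in>A. cinner x (f i))"
  by (induction A rule: infinite_finite_induct) (simp_all add: cinner_zero_right cinner_add_right)

lemma cinner_diff_left: "cinner (x - y) (z::'a::fd_complex_hilbert) = cinner x z - cinner y z"
  using cinner_add_left[of "x - y" y z] by simp

lemma cinner_self: "cinner (x::'a::fd_complex_hilbert) x = complex_of_real ((norm x)\<^sup>2)"
proof -
  have "Im (cinner x x) = 0"
    using arg_cong[OF cinner_commute[of x x], of Im] by simp
  moreover have "Re (cinner x x) = (norm x)\<^sup>2"
    by (simp add: dot_square_norm flip: inner_Re_cinner)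
  ultimately show ?thesis by (simp add: complex_eq_iff)
qed

lemma norm_scaleC: "norm (c *\<^sub>C (x::'a::fd_complex_hilbert)) = cmod c * norm x"
proof -
  have "complex_of_real ((norm (c *\<^sub>C x))\<^sup>2) = (c * cnj c) * cinner x x"
    by (simp only: cinner_self[symmetric] cinner_scaleC_left cinner_scaleC_right mult_ac)
  also have "\<dots> = complex_of_real ((cmod c * norm x)\<^sup>2)"
    by (simp only: cinner_self complex_norm_square[symmetric] of_real_mult[symmetric] power_mult_distrib of_real_power[symmetric])
  finally have "(norm (c *\<^sub>C x))\<^sup>2 = (cmod c * norm x)\<^sup>2"
    by (simp only: of_real_eq_iff)
  then show ?thesis by simp
qed

lemma bounded_bilinear_scaleC:
  "bounded_bilinear (scaleC :: complex \<Rightarrow> 'a::fd_complex_hilbert \<Rightarrow> 'a)"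
proof
  show "(r *\<^sub>R a) *\<^sub>C (b::'a) = r *\<^sub>R (a *\<^sub>C b)" for r a b
    by (simp only: scaleR_conv_of_real scaleR_scaleC[of r "a *\<^sub>C b"] scaleC_scaleC)
  show "a *\<^sub>C (r *\<^sub>R (b::'a)) = r *\<^sub>R (a *\<^sub>C b)" for r a b
    by (simp add: scaleR_scaleC scaleC_scaleC mult.commute)
  show "\<exists>K. \<forall>a (b::'a). norm (a *\<^sub>C b) \<le> norm a * norm b * K"
    by (rule exI[of _ 1]) (simp add: norm_scaleC)
qed (simp_all add: scaleC_add_left scaleC_add_right)

lemmas continuous_on_scaleC [continuous_intros] = bounded_bilinear.continuous_on[OF bounded_bilinear_scaleC]
lemmas tendsto_scaleC [tendsto_intros] = bounded_bilinear.tendsto[OF bounded_bilinear_scaleC]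

lemma
  assumes "clinear f"
  shows clinear_add: "f (x + y) = f x + f y" and clinear_scaleC: "f (c *\<^sub>C x) = c *\<^sub>C f x"
    and clinear_zero: "f 0 = 0" and clinear_diff: "f (x - y) = f x - f y"
proof -
  show *: "f (x + y) = f x + f y" and **: "f (c *\<^sub>C x) = c *\<^sub>C f x" for x y c
    using assms by (auto simp: clinear_def)
  show "f 0 = 0" using *[of 0 0] by simp
  show "f (x - y) = f x - f y" using *[of "x - y" y] by simp
qed

lemma clinear_sum: "clinear f \<Longrightarrow> f (\<Sum>i\<in>A. g i) = (\<Sum>i\<in>A. f (g i))"
  by (induction A rule: infinite_finite_induct) (simp_all add: clinear_zero clinear_add)

text \<open>
  Gram-Schmidt, one vector at a time: the residual of a new vector after subtracting its expansion
  is either zero, so nothing has to be added, or normalises to a new member of the system.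
\<close>

lemma orthonormal_expansion:
  fixes S :: "'a::fd_complex_hilbert set"
  assumes "finite S"
  shows "\<exists>B. finite B \<and> (\<forall>a\<in>B. \<forall>b\<in>B. cinner a b = (if a = b then 1 else 0)) \<and>
     (\<forall>s\<in>S. s = (\<Sum>b\<in>B. cinner s b *\<^sub>C b))"
  using assms
proof (induction S)
  case empty
  then show ?case by (intro exI[of _ "{}"]) auto
next
  case (insert s S)
  then obtain B where B: "finite B" "\<And>a b. a \<in> B \<Longrightarrow> b \<in> B \<Longrightarrow> cinner a b = (if a = b then 1 else 0)"
    "\<And>t. t \<in> S \<Longrightarrow> t = (\<Sum>b\<in>B. cinner t b *\<^sub>C b)" by metis
  define r where "r = s - (\<Sum>b\<in>B. cinner s b *\<^sub>C b)"
  have r_orth: "cinner r a = 0" if "a \<in> B" for a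
  proof -
    have "cinner r a = cinner s a - (\<Sum>b\<in>B. cinner s b * (if b = a then 1 else 0))"
      unfolding r_def using that by (simp add: cinner_diff_left cinner_sum_left cinner_scaleC_left B(2))
    also have "\<dots> = 0" using that B(1) by (simp add: if_distrib[of "(*) _"] cong: if_cong)
    finally show ?thesis .
  qed
  show ?case
  proof (cases "r = 0")
    case True
    then show ?thesis using B by (intro exI[of _ B]) (auto simp: r_def)
  next
    case False
    define u where "u = complex_of_real (inverse (norm r)) *\<^sub>C r"
    have u_orth: "cinner u a = 0" "cinner a u = 0" if "a \<in> B" for a
      using r_orth[OF that] cinner_commute[of u a] by (simp_all add: u_def cinner_scaleC_left)
    have "norm u = 1" using False by (simp add: u_def norm_scaleC norm_inverse)
    then have uu: "cinner u u = 1" by (simp add: cinner_self)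
    have uB: "u \<notin> B" using u_orth(1)[of u] uu by auto
    have ru: "r = complex_of_real (norm r) *\<^sub>C u"
      using False by (simp add: u_def scaleC_scaleC scaleC_one flip: of_real_mult)
    have s: "s = r + (\<Sum>b\<in>B. cinner s b *\<^sub>C b)" by (simp add: r_def)
    have "cinner s u = cinner r u"
      by (subst s) (simp add: cinner_add_left cinner_sum_left cinner_scaleC_left u_orth)
    also have "\<dots> = complex_of_real (norm r)"
      by (subst ru) (simp add: cinner_scaleC_left uu)
    finally have "s = (\<Sum>b\<in>insert u B. cinner s b *\<^sub>C b)"
      using s ru uB B(1) by simp
    moreover have "t = (\<Sum>b\<in>insert u B. cinner t b *\<^sub>C b)" if "t \<in> S" for t
    proof -
      have "cinner t u = 0"
        by (subst B(3)[OF that]) (simp add: cinner_sum_left cinner_scaleC_left u_orth)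
      then show ?thesis using B(3)[OF that] uB B(1) by (simp add: scaleC_zero_left)
    qed
    ultimately show ?thesis
      using B uu u_orth uB by (intro exI[of _ "insert u B"]) auto
  qed
qed

lemma ex_finite_expansion:
  "\<exists>B::'a::fd_complex_hilbert set. finite B \<and> (\<forall>x. x = (\<Sum>b\<in>B. cinner x b *\<^sub>C b))"
proof -
  obtain S :: "'a set" where S: "finite S" "\<And>x. \<exists>c. x = (\<Sum>s\<in>S. c s *\<^sub>C s)"
    using finite_spanning by blast
  obtain B :: "'a set" where B: "finite B" "\<And>s. s \<in> S \<Longrightarrow> s = (\<Sum>b\<in>B. cinner s b *\<^sub>C b)"
    using orthonormal_expansion[OF S(1)] by metis
  have "x = (\<Sum>b\<in>B. cinner x b *\<^sub>C b)" for x
  proof -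
    obtain c where c: "x = (\<Sum>s\<in>S. c s *\<^sub>C s)" using S(2) by blast
    have "x = (\<Sum>s\<in>S. c s *\<^sub>C (\<Sum>b\<in>B. cinner s b *\<^sub>C b))"
      unfolding c using B(2) by (intro sum.cong) auto
    also have "\<dots> = (\<Sum>b\<in>B. \<Sum>s\<in>S. (c s * cinner s b) *\<^sub>C b)"
      by (simp add: scaleC_sum_right scaleC_scaleC) (rule sum.swap)
    also have "\<dots> = (\<Sum>b\<in>B. cinner x b *\<^sub>C b)"
      unfolding c by (simp add: cinner_sum_left cinner_scaleC_left scaleC_sum_left)
    finally show ?thesis .
  qed
  then show ?thesis using B(1) by blast
qed

lemma norm_cinner_le: "cmod (cinner x (b::'a::fd_complex_hilbert)) \<le> norm x * norm b"
proof -
  (* Multiplying x by c makes the inner product real and nonnegative. *)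
  define c where "c = cnj (sgn (cinner x b))"
  have "cmod (cinner x b) = Re (cinner (c *\<^sub>C x) b)"
    by (cases "cinner x b = 0")
       (simp_all add: c_def cinner_scaleC_left sgn_eq field_simps flip: complex_norm_square power2_eq_square)
  also have "\<dots> \<le> norm (c *\<^sub>C x) * norm b"
    using norm_cauchy_schwarz[of "c *\<^sub>C x" b] by (simp add: inner_Re_cinner)
  also have "\<dots> \<le> norm x * norm b"
    by (intro mult_right_mono) (auto simp: norm_scaleC c_def norm_sgn)
  finally show ?thesis .
qed

lemma clinear_imp_bounded_linear:
  fixes f :: "'a::fd_complex_hilbert \<Rightarrow> 'b::fd_complex_hilbert"
  assumes "clinear f"
  shows "bounded_linear f"
proof -
  obtain B :: "'a set" where B: "\<And>x. x = (\<Sum>b\<in>B. cinner x b *\<^sub>C b)"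
    using ex_finite_expansion by blast
  show ?thesis
  proof (rule bounded_linear_intro)
    show "f (x + y) = f x + f y" for x y by (rule clinear_add[OF assms])
    show "f (r *\<^sub>R x) = r *\<^sub>R f x" for r x by (simp add: scaleR_scaleC clinear_scaleC[OF assms])
    fix x
    have "norm (f x) = norm (\<Sum>b\<in>B. cinner x b *\<^sub>C f b)"
      by (subst B[of x]) (simp add: clinear_sum[OF assms] clinear_scaleC[OF assms])
    also have "\<dots> \<le> (\<Sum>b\<in>B. norm x * norm b * norm (f b))"
      by (intro sum_norm_le) (auto simp: norm_scaleC intro!: mult_right_mono norm_cinner_le)
    also have "\<dots> = norm x * (\<Sum>b\<in>B. norm b * norm (f b))"
      by (simp add: sum_distrib_left mult.assoc)
    finally show "norm (f x) \<le> norm x * (\<Sum>b\<in>B. norm b * norm (f b))" .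
  qed
qed

text \<open>
  Completeness and separability are both read off in the coordinates of a finite expansion. They
  make measurability of sums, and of limits of sequences, available for vector-valued functions.
\<close>

instance fd_complex_hilbert \<subseteq> banach
proof
  fix X :: "nat \<Rightarrow> 'a"
  assume "Cauchy X"
  obtain B :: "'a set" where B: "\<And>x. x = (\<Sum>b\<in>B. cinner x b *\<^sub>C b)"
    using ex_finite_expansion by blast
  have "convergent (\<lambda>n. cinner (X n) b)" for b
  proof -
    have "bounded_linear (\<lambda>x. cinner x b)"
      by (rule bounded_linear_intro[of _ "norm b"])
         (simp_all only: cinner_add_left scaleR_scaleC[where 'a='a] cinner_scaleC_left norm_cinner_le
            scaleR_conv_of_real)
    from bounded_linear.Cauchy[OF this \<open>Cauchy X\<close>] show ?thesis by (rule Cauchy_convergent)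
  qed
  then obtain c where c: "\<And>b. (\<lambda>n. cinner (X n) b) \<longlonglongrightarrow> c b" unfolding convergent_def by metis
  have "(\<lambda>n. \<Sum>b\<in>B. cinner (X n) b *\<^sub>C b) \<longlonglongrightarrow> (\<Sum>b\<in>B. c b *\<^sub>C b)"
    by (intro tendsto_intros c)
  then show "convergent X" unfolding convergent_def by (subst (asm) B[symmetric]) blast
qed

instance fd_complex_hilbert \<subseteq> second_countable_topology
proof
  obtain B :: "'a set" where fB: "finite B" and B: "\<And>x. x = (\<Sum>b\<in>B. cinner x b *\<^sub>C b)"
    using ex_finite_expansion by blast
  obtain D0 :: "complex set" where D0: "countable D0" "\<And>U. open U \<Longrightarrow> U \<noteq> {} \<Longrightarrow> \<exists>d\<in>D0. d \<in> U"
    using countable_dense_setE by blast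
  define D :: "'a set" where "D = (\<lambda>c. \<Sum>b\<in>B. c b *\<^sub>C b) ` PiE B (\<lambda>_. D0)"
  have cD: "countable D" unfolding D_def by (intro countable_image countable_PiE fB D0(1))
  have dense: "\<exists>d\<in>D. dist x d < e" if "e > 0" for x e
  proof -
    define \<delta> where "\<delta> = e / (1 + (\<Sum>b\<in>B. norm b))"
    have s0: "(\<Sum>b\<in>B. norm b) \<ge> 0" by (simp add: sum_nonneg)
    have "\<delta> > 0" using that s0 by (simp add: \<delta>_def)
    then have "\<exists>d\<in>D0. d \<in> ball (cinner x b) \<delta>" for b by (intro D0(2)) auto
    then obtain c where c: "\<And>b. c b \<in> D0" "\<And>b. cmod (cinner x b - c b) < \<delta>"
      by (simp add: dist_norm) metis
    have "dist x (\<Sum>b\<in>B. c b *\<^sub>C b) = norm (\<Sum>b\<in>B. (cinner x b - c b) *\<^sub>C b)"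
      by (subst B[of x]) (simp add: dist_norm scaleC_diff_left sum_subtractf)
    also have "\<dots> \<le> (\<Sum>b\<in>B. \<delta> * norm b)"
      by (intro sum_norm_le) (auto simp: norm_scaleC intro!: mult_right_mono less_imp_le[OF c(2)])
    also have "\<dots> = \<delta> * (\<Sum>b\<in>B. norm b)" by (simp add: sum_distrib_left)
    also have "\<dots> < e" using that s0 by (simp add: \<delta>_def field_simps)
    finally have "dist x (\<Sum>b\<in>B. c b *\<^sub>C b) < e" .
    moreover have "(\<Sum>b\<in>B. c b *\<^sub>C b) \<in> D"
      unfolding D_def
    proof (rule image_eqI[of _ _ "restrict c B"])
      show "restrict c B \<in> PiE B (\<lambda>_. D0)" by (intro restrict_PiE_iff[THEN iffD2] ballI c(1))
    qed simp
    ultimately show ?thesis by blast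
  qed
  let ?\<B> = "(\<lambda>(d, q). ball d (real_of_rat q)) ` (D \<times> UNIV)"
  have "topological_basis ?\<B>"
  proof (rule topological_basisI)
    show "open U" if "U \<in> ?\<B>" for U using that by auto
    fix U and x :: 'a
    assume "open U" "x \<in> U"
    then obtain e where e: "e > 0" "ball x e \<subseteq> U" by (meson open_contains_ball)
    obtain q where q: "0 < real_of_rat q" "real_of_rat q < e / 2"
      using of_rat_dense[of 0 "e/2"] e(1) by auto
    obtain d where d: "d \<in> D" "dist x d < real_of_rat q" using dense[OF q(1)] by blast
    show "\<exists>U'\<in>?\<B>. x \<in> U' \<and> U' \<subseteq> U"
    proof (intro bexI conjI)
      show "x \<in> ball d (real_of_rat q)" using d by (simp add: dist_commute)
      show "ball d (real_of_rat q) \<subseteq> U"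
      proof
        fix y assume "y \<in> ball d (real_of_rat q)"
        then have "dist x y < e" using d(2) q(2) dist_triangle[of x y d] by simp
        then show "y \<in> U" using e(2) by auto
      qed
    qed (use d in auto)
  qed
  moreover have "countable ?\<B>" using cD by auto
  ultimately show "\<exists>\<B>::'a set set. countable \<B> \<and> open = generate_topology \<B>"
    by (auto dest: topological_basis_imp_subbasis)
qed

section \<open>Characters separate points\<close>

text \<open>
  The graph of a character of a subgroup: a subgroup of the product of the group with the circle
  that meets the circle trivially. The last clause says just this, and it makes the relation
  single-valued. Graphs, unlike functions with a domain, are ordered by inclusion, as Zorn's lemma
  wants.
\<close>

definition partial_character :: "('g::ab_group_add \<times> complex) set \<Rightarrow> bool" where
  "partial_character M \<longleftrightarrow>
     (0, 1) \<in> M \<and>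
     (\<forall>x z. (x, z) \<in> M \<longrightarrow> cmod z = 1 \<and> (- x, cnj z) \<in> M) \<and>
     (\<forall>x z y w. (x, z) \<in> M \<longrightarrow> (y, w) \<in> M \<longrightarrow> (x + y, z * w) \<in> M) \<and>
     (\<forall>z. (0, z) \<in> M \<longrightarrow> z = 1)"

text \<open>
  The multiple \<open>n \<cdot> a\<close> in a group without a ring structure; integer multiples are written below as
  differences of two of these.
\<close>

definition nat_multiple :: "nat \<Rightarrow> 'g::ab_group_add \<Rightarrow> 'g" where
  "nat_multiple n a = ((+) a ^^ n) 0"

lemma nat_multiple_simps [simp]:
  "nat_multiple 0 a = 0" "nat_multiple (Suc n) a = a + nat_multiple n a"
  by (simp_all add: nat_multiple_def)

lemma nat_multiple_add: "nat_multiple (m + n) a = nat_multiple m a + nat_multiple n a"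
  by (induction m) (simp_all add: add.assoc)

lemma unit_complex_cancel: "cmod z = 1 \<Longrightarrow> z * cnj z = 1" "cmod z = 1 \<Longrightarrow> cnj z * z = 1"
  by (simp_all add: complex_norm_square[symmetric] mult.commute[of "cnj z"])

lemma partial_characterD:
  assumes "partial_character M"
  shows "(0, 1) \<in> M" "(x, z) \<in> M \<Longrightarrow> cmod z = 1" "(x, z) \<in> M \<Longrightarrow> (- x, cnj z) \<in> M"
    "(x, z) \<in> M \<Longrightarrow> (y, w) \<in> M \<Longrightarrow> (x + y, z * w) \<in> M" "(0, z) \<in> M \<Longrightarrow> z = 1"
  using assms by (auto simp: partial_character_def)

lemma partial_character_unique:
  assumes M: "partial_character M" and "(x, z) \<in> M" "(x, w) \<in> M"
  shows "z = w"
proof -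
  have "(x + - x, z * cnj w) \<in> M" using assms by (intro partial_characterD) auto
  then have "z * cnj w = 1" using partial_characterD(5)[OF M] by simp
  then have "z * (cnj w * w) = w" by (simp flip: mult.assoc)
  then show ?thesis using partial_characterD(2)[OF M assms(3)] by (simp add: unit_complex_cancel)
qed

text \<open>
  There are \<open>n \<ge> 2\<close> roots, so they cannot all be 1. Being able to avoid 1 is what later makes the
  character nontrivial at the prescribed element.
\<close>

lemma ex_nontrivial_root:
  assumes "n \<ge> 2" "cmod w = 1"
  shows "\<exists>\<zeta>. cmod \<zeta> = 1 \<and> \<zeta> \<noteq> 1 \<and> \<zeta> ^ n = w"
proof -
  have "card {z. z ^ n = w} = n" using assms by (intro card_nth_roots) auto
  then have "\<not> {z. z ^ n = w} \<subseteq> {1}" using assms card_mono[of "{1}" "{z. z ^ n = w}"] by auto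
  then obtain \<zeta> where \<zeta>: "\<zeta> ^ n = w" "\<zeta> \<noteq> 1" by blast
  have "cmod \<zeta> ^ n = 1" using \<zeta>(1) assms(2) by (simp flip: norm_power)
  then have "cmod \<zeta> = 1" using assms(1) power_eq_iff_eq_base[of n "cmod \<zeta>" 1] by simp
  with \<zeta> show ?thesis by blast
qed

text \<open>
  If no positive multiple of \<open>a\<close> lies in the domain, any unimodular value other than 1 is
  admissible. Otherwise let \<open>n\<close> be
  the least such multiple; it is at least 2 because \<open>a\<close> itself is not in the domain. All multiples
  in the domain are then multiples of \<open>n \<cdot> a\<close>, and any \<open>n\<close>-th root other than 1 of the value
  there will do.
\<close>

lemma ex_compatible_value:
  assumes M: "partial_character M" and a: "a \<notin> Domain M"
  shows "\<exists>\<zeta>. cmod \<zeta> = 1 \<and> \<zeta> \<noteq> 1 \<and> (\<forall>d z. (nat_multiple d a, z) \<in> M \<longrightarrow> z = \<zeta> ^ d)"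
proof (cases "\<exists>n>0. nat_multiple n a \<in> Domain M")
  case False
  then show ?thesis
    using partial_characterD(5)[OF M]
    by (intro exI[of _ "-1"]) (auto, metis DomainI gr0I nat_multiple_simps(1) power_0)
next
  case True
  define n where "n = (LEAST n. n > 0 \<and> nat_multiple n a \<in> Domain M)"
  have n: "n > 0" "nat_multiple n a \<in> Domain M"
    using LeastI_ex[OF True] by (auto simp: n_def)
  have least: "n \<le> m" if "m > 0" "nat_multiple m a \<in> Domain M" for m
    unfolding n_def using that by (intro Least_le) auto
  obtain w where w: "(nat_multiple n a, w) \<in> M" using n(2) by blast
  have "n \<noteq> 1" using a n(2) by auto
  then obtain \<zeta> where \<zeta>: "cmod \<zeta> = 1" "\<zeta> \<noteq> 1" "\<zeta> ^ n = w"
    using ex_nontrivial_root[of n w] n(1) partial_characterD(2)[OF M w] by force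
  have "z = \<zeta> ^ d" if "(nat_multiple d a, z) \<in> M" for d z
    using that
  proof (induction d arbitrary: z rule: less_induct)
    case (less d)
    show ?case
    proof (cases "d = 0")
      case True
      then show ?thesis using less.prems partial_characterD(5)[OF M] by simp
    next
      case False
      then have "n \<le> d" using least less.prems by blast
      have d: "nat_multiple d a = nat_multiple n a + nat_multiple (d - n) a"
        using \<open>n \<le> d\<close> by (simp flip: nat_multiple_add)
      have "(nat_multiple d a + - nat_multiple n a, z * cnj w) \<in> M"
        using less.prems w partial_characterD[OF M] by blast
      then have "(nat_multiple (d - n) a, z * cnj w) \<in> M" using d by simp
      then have "z * cnj w = \<zeta> ^ (d - n)" using n(1) False by (intro less.IH) auto
      then have "z * (cnj w * w) = \<zeta> ^ (d - n) * \<zeta> ^ n" by (simp add: \<zeta>(3) flip: mult.assoc)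
      then show ?thesis
        using partial_characterD(2)[OF M w] \<open>n \<le> d\<close>
        by (simp add: unit_complex_cancel flip: power_add)
    qed
  qed
  with \<zeta> show ?thesis by blast
qed

text \<open>
  The graph is enlarged by all combinations \<open>x + j \<cdot> a - k \<cdot> a\<close>. It stays single-valued because a
  relation \<open>x + j \<cdot> a = k \<cdot> a\<close> puts the multiple \<open>\<bar>k - j\<bar> \<cdot> a\<close> into the old domain, where the
  chosen value is compatible.
\<close>

lemma extend_partial_character:
  assumes M: "partial_character M" and a: "a \<notin> Domain M"
  shows "\<exists>M' \<zeta>. partial_character M' \<and> M \<subseteq> M' \<and> (a, \<zeta>) \<in> M' \<and> \<zeta> \<noteq> 1"
proof -
  obtain \<zeta> where \<zeta>: "cmod \<zeta> = 1" "\<zeta> \<noteq> 1" "\<And>d z. (nat_multiple d a, z) \<in> M \<Longrightarrow> z = \<zeta> ^ d"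
    using ex_compatible_value[OF assms] by blast
  define M' where "M' = {(x + nat_multiple j a - nat_multiple k a, z * \<zeta> ^ j * cnj \<zeta> ^ k) |x z j k. (x, z) \<in> M}"
  have M'I: "(x + nat_multiple j a - nat_multiple k a, z * \<zeta> ^ j * cnj \<zeta> ^ k) \<in> M'"
    if "(x, z) \<in> M" for x z j k using that unfolding M'_def by blast
  have unit: "\<zeta> ^ j * cnj \<zeta> ^ j = 1" for j
    using \<zeta>(1) by (simp add: unit_complex_cancel flip: power_mult_distrib)
  have "partial_character M'"
    unfolding partial_character_def
  proof (intro conjI allI impI)
    show "(0, 1) \<in> M'" using M'I[OF partial_characterD(1)[OF M], of 0 0] by simp
    fix y w assume "(y, w) \<in> M'"
    then obtain x z j k where yw: "(x, z) \<in> M" "y = x + nat_multiple j a - nat_multiple k a"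
      "w = z * \<zeta> ^ j * cnj \<zeta> ^ k" unfolding M'_def by blast
    show "cmod w = 1" using yw(3) \<zeta>(1) partial_characterD(2)[OF M yw(1)]
      by (simp add: norm_mult norm_power)
    have "(- x + nat_multiple k a - nat_multiple j a, cnj z * \<zeta> ^ k * cnj \<zeta> ^ j) \<in> M'"
      using partial_characterD(3)[OF M yw(1)] by (rule M'I)
    then show "(- y, cnj w) \<in> M'" by (simp add: yw algebra_simps)
    fix y' w' assume "(y', w') \<in> M'"
    then obtain x' z' j' k' where yw': "(x', z') \<in> M" "y' = x' + nat_multiple j' a - nat_multiple k' a"
      "w' = z' * \<zeta> ^ j' * cnj \<zeta> ^ k'" unfolding M'_def by blast
    have "((x + x') + nat_multiple (j + j') a - nat_multiple (k + k') a,
        (z * z') * \<zeta> ^ (j + j') * cnj \<zeta> ^ (k + k')) \<in> M'"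
      using partial_characterD(4)[OF M yw(1) yw'(1)] by (rule M'I)
    then show "(y + y', w * w') \<in> M'"
      by (simp add: yw yw' nat_multiple_add power_add algebra_simps)
  next
    fix w assume "(0, w) \<in> M'"
    then obtain x z j k where xz: "(x, z) \<in> M" "0 = x + nat_multiple j a - nat_multiple k a"
      "w = z * \<zeta> ^ j * cnj \<zeta> ^ k" unfolding M'_def by blast
    show "w = 1"
    proof (cases "j \<le> k")
      case True
      then obtain d where k: "k = d + j" using nat_le_iff_add[of j k] by (metis add.commute)
      have "x = nat_multiple d a" using xz(2) by (simp add: k nat_multiple_add)
      then have "z = \<zeta> ^ d" using \<zeta>(3) xz(1) by simp
      then have "w = (\<zeta> ^ k) * cnj \<zeta> ^ k" by (simp add: xz(3) k power_add)
      then show ?thesis by (simp only: unit)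
    next
      case False
      then obtain d where j: "j = d + k" using nat_le_iff_add[of k j] by (metis add.commute nat_le_linear)
      have "- x = nat_multiple d a" using xz(2) by (simp add: j nat_multiple_add neg_eq_iff_add_eq_0 add.commute)
      then have "cnj z = \<zeta> ^ d" using \<zeta>(3) partial_characterD(3)[OF M xz(1)] by simp
      then have "z = cnj \<zeta> ^ d" by (metis complex_cnj_cnj complex_cnj_power)
      then have "w = (\<zeta> ^ j) * cnj \<zeta> ^ j" by (simp add: xz(3) j power_add)
      then show ?thesis by (simp only: unit)
    qed
  qed
  moreover have "M \<subseteq> M'"
  proof (rule subrelI)
    fix x z assume "(x, z) \<in> M"
    from M'I[OF this, of 0 0] show "(x, z) \<in> M'" by simp
  qed
  moreover have "(a, \<zeta>) \<in> M'" using M'I[OF partial_characterD(1)[OF M], of 1 0] by simp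
  ultimately show ?thesis using \<zeta>(2) by blast
qed

text \<open>
  The extension lemma is used twice: first at \<open>a\<close>, starting from the trivial subgroup, to obtain a
  value other than 1, and then to see that a maximal graph has full domain.
\<close>

lemma characters_separate_points:
  fixes a :: "'g::ab_group_add"
  assumes "a \<noteq> 0"
  shows "\<exists>\<psi>\<in>dual_group. \<psi> a \<noteq> 1"
proof -
  have "partial_character {(0::'g, 1)}" by (simp add: partial_character_def)
  then obtain M0 \<zeta> where M0: "partial_character M0" "(a, \<zeta>) \<in> M0" "\<zeta> \<noteq> 1"
    using extend_partial_character[of "{(0, 1)}" a] assms by auto
  define \<A> where "\<A> = {M. partial_character M \<and> M0 \<subseteq> M}"
  have "\<exists>U\<in>\<A>. \<forall>M\<in>\<A>. U \<subseteq> M \<longrightarrow> M = U"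
  proof (rule subset_Zorn_nonempty)
    show "\<A> \<noteq> {}" using M0(1) by (auto simp: \<A>_def)
    fix \<C> assume ne: "\<C> \<noteq> {}" and chain: "subset.chain \<A> \<C>"
    have C: "partial_character M" "M0 \<subseteq> M" if "M \<in> \<C>" for M
      using chain that by (auto simp: \<A>_def subset.chain_def)
    have "partial_character (\<Union>\<C>)"
      unfolding partial_character_def
    proof (intro conjI allI impI)
      show "(0, 1) \<in> \<Union>\<C>" using ne partial_characterD(1)[OF C(1)] by blast
      show "z = 1" if "(0, z) \<in> \<Union>\<C>" for z using that partial_characterD(5)[OF C(1)] by blast
      fix x z assume xz: "(x, z) \<in> \<Union>\<C>"
      then show "cmod z = 1" "(- x, cnj z) \<in> \<Union>\<C>" using partial_characterD(2,3)[OF C(1)] by blast+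
      fix y w assume "(y, w) \<in> \<Union>\<C>"
      with xz obtain M N where MN: "M \<in> \<C>" "N \<in> \<C>" "(x, z) \<in> M" "(y, w) \<in> N" by blast
      have "M \<subseteq> N \<or> N \<subseteq> M" using chain MN by (auto simp: subset.chain_def)
      then show "(x + y, z * w) \<in> \<Union>\<C>" using MN partial_characterD(4)[OF C(1)] by blast
    qed
    then show "\<Union>\<C> \<in> \<A>" using ne C(2) by (auto simp: \<A>_def)
  qed
  then obtain M where M: "partial_character M" "M0 \<subseteq> M"
    and max: "\<And>N. partial_character N \<Longrightarrow> M \<subseteq> N \<Longrightarrow> N = M"
    by (force simp: \<A>_def)
  have "x \<in> Domain M" for x
    using extend_partial_character[OF M(1), of x] max by blast
  then obtain \<psi> where \<psi>: "\<And>x. (x, \<psi> x) \<in> M" unfolding Domain_iff by metis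
  have "\<psi> (x + y) = \<psi> x * \<psi> y" for x y
    using partial_character_unique[OF M(1) \<psi>] partial_characterD(4)[OF M(1) \<psi> \<psi>] by blast
  then have "\<psi> \<in> dual_group" using partial_characterD(2)[OF M(1) \<psi>] by (simp add: dual_group_def)
  moreover have "\<psi> a = \<zeta>" using partial_character_unique[OF M(1) \<psi>] M0(2) M(2) by blast
  ultimately show ?thesis using M0(3) by blast
qed

section \<open>Orthogonality of the evaluations\<close>

lemma dual_groupD:
  assumes "\<xi> \<in> dual_group"
  shows "\<xi> (a + b) = \<xi> a * \<xi> b" "cmod (\<xi> a) = 1" "\<xi> 0 = 1" "\<xi> (- a) = cnj (\<xi> a)"
    "\<xi> a * cnj (\<xi> a) = 1"
proof -
  show add: "\<xi> (a + b) = \<xi> a * \<xi> b" and n: "cmod (\<xi> a) = 1" for a b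
    using assms by (auto simp: dual_group_def)
  show z: "\<xi> 0 = 1" using add[of 0 0] n[of 0] by auto
  show c: "\<xi> a * cnj (\<xi> a) = 1" by (rule unit_complex_cancel(1)[OF n])
  have "\<xi> (- a) * \<xi> a = 1" using add[of "- a" a] z by simp
  then have "\<xi> (- a) * (\<xi> a * cnj (\<xi> a)) = cnj (\<xi> a)" by (simp flip: mult.assoc)
  then show "\<xi> (- a) = cnj (\<xi> a)" by (simp add: c)
qed

lemma haar_space: "haar_probability \<mu> \<Longrightarrow> space \<mu> = dual_group"
  using sets_eq_imp_space_eq[of \<mu> "restrict_space borel dual_group"]
  by (simp add: haar_probability_def space_restrict_space)

lemma haar_measurable_eq:
  "haar_probability \<mu> \<Longrightarrow> borel_measurable \<mu> = borel_measurable (restrict_space borel dual_group)"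
  unfolding haar_probability_def by (intro measurable_cong_sets) auto

lemma measurable_evaluation:
  fixes \<mu> :: "('g::ab_group_add \<Rightarrow> complex) measure"
  assumes "haar_probability \<mu>"
  shows "(\<lambda>\<xi>. \<xi> \<gamma>) \<in> borel_measurable \<mu>"
  unfolding haar_measurable_eq[OF assms]
  by (intro measurable_restrict_space1 borel_measurable_continuous_onI continuous_on_product_coordinates)

text \<open>
  Invariance is assumed for images of sets. The push-forward measure uses preimages, and the
  preimage under multiplication by \<open>\<psi>\<close> is the image under multiplication by its conjugate.
\<close>

lemma haar_translation:
  fixes \<mu> :: "('g::ab_group_add \<Rightarrow> complex) measure"
  assumes \<mu>: "haar_probability \<mu>" and \<psi>: "\<psi> \<in> dual_group"
  shows "(\<lambda>\<xi> \<gamma>. \<psi> \<gamma> * \<xi> \<gamma>) \<in> measurable \<mu> \<mu>" (is "?T \<in> _")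
    and "distr \<mu> \<mu> (\<lambda>\<xi> \<gamma>. \<psi> \<gamma> * \<xi> \<gamma>) = \<mu>"
proof -
  have sets: "sets \<mu> = sets (restrict_space borel dual_group)"
    using \<mu> by (simp add: haar_probability_def)
  have closed: "(\<lambda>\<gamma>. \<psi> \<gamma> * \<xi> \<gamma>) \<in> dual_group" if "\<psi> \<in> dual_group" "\<xi> \<in> dual_group" for \<psi> \<xi> :: "'g \<Rightarrow> complex"
    using that by (simp add: dual_group_def norm_mult)
  have "continuous_on UNIV ?T"
    by (intro continuous_on_coordinatewise_then_product continuous_intros continuous_on_product_coordinates)
  then have "?T \<in> measurable (restrict_space borel dual_group) (restrict_space borel dual_group)"
    using closed[OF \<psi>]
    by (intro measurable_restrict_space2 measurable_restrict_space1 borel_measurable_continuous_onI)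
       (auto simp: space_restrict_space)
  then show meas: "?T \<in> measurable \<mu> \<mu>"
    using measurable_cong_sets[OF sets sets] by blast
  have conj: "(\<lambda>\<gamma>. cnj (\<psi> \<gamma>)) \<in> dual_group" using \<psi> by (simp add: dual_group_def)
  show "distr \<mu> \<mu> ?T = \<mu>"
  proof (rule measure_eqI)
    fix A assume "A \<in> sets (distr \<mu> \<mu> ?T)"
    then have A: "A \<in> sets \<mu>" by simp
    then have AD: "A \<subseteq> dual_group" using sets.sets_into_space haar_space[OF \<mu>] by blast
    have "?T -` A \<inter> space \<mu> = (\<lambda>\<xi> \<gamma>. cnj (\<psi> \<gamma>) * \<xi> \<gamma>) ` A"
    proof (intro equalityI subsetI)
      fix \<xi> assume "\<xi> \<in> ?T -` A \<inter> space \<mu>"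
      then show "\<xi> \<in> (\<lambda>\<xi> \<gamma>. cnj (\<psi> \<gamma>) * \<xi> \<gamma>) ` A"
        by (intro image_eqI[of _ _ "?T \<xi>"])
           (auto simp: fun_eq_iff unit_complex_cancel dual_groupD[OF \<psi>] simp flip: mult.assoc)
    next
      fix \<xi> assume "\<xi> \<in> (\<lambda>\<xi> \<gamma>. cnj (\<psi> \<gamma>) * \<xi> \<gamma>) ` A"
      then obtain \<eta> where \<eta>: "\<eta> \<in> A" "\<xi> = (\<lambda>\<gamma>. cnj (\<psi> \<gamma>) * \<eta> \<gamma>)" by blast
      have "?T \<xi> = \<eta>"
        by (auto simp: \<eta>(2) fun_eq_iff dual_groupD[OF \<psi>] simp flip: mult.assoc)
      moreover have "\<xi> \<in> dual_group" unfolding \<eta>(2) using \<eta>(1) AD by (intro closed[OF conj]) auto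
      ultimately show "\<xi> \<in> ?T -` A \<inter> space \<mu>" using \<eta>(1) haar_space[OF \<mu>] by simp
    qed
    then show "emeasure (distr \<mu> \<mu> ?T) A = emeasure \<mu> A"
      using \<mu> conj A by (simp add: emeasure_distr[OF meas A] haar_probability_def)
  qed simp
qed

text \<open>
  Translation by \<open>\<psi>\<close> multiplies the integral by \<open>\<psi> \<gamma>\<close>; if that is not 1, the integral is 0.
\<close>

lemma integral_character:
  fixes \<mu> :: "('g::ab_group_add \<Rightarrow> complex) measure"
  assumes \<mu>: "haar_probability \<mu>"
  shows "(\<integral>\<xi>. \<xi> \<gamma> \<partial>\<mu>) = (if \<gamma> = 0 then 1 else 0)"
proof (cases "\<gamma> = 0")
  case True
  interpret prob_space \<mu> using \<mu> by (simp add: haar_probability_def)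
  have "(\<integral>\<xi>. \<xi> \<gamma> \<partial>\<mu>) = (\<integral>\<xi>. 1 \<partial>\<mu>)"
    using True by (intro Bochner_Integration.integral_cong) (auto simp: haar_space[OF \<mu>] dual_groupD(3))
  then show ?thesis using True by (simp add: prob_space)
next
  case False
  then obtain \<psi> where \<psi>: "\<psi> \<in> dual_group" "\<psi> \<gamma> \<noteq> 1" using characters_separate_points by blast
  have "(\<integral>\<xi>. \<xi> \<gamma> \<partial>\<mu>) = (\<integral>\<xi>. \<xi> \<gamma> \<partial>distr \<mu> \<mu> (\<lambda>\<xi> \<gamma>. \<psi> \<gamma> * \<xi> \<gamma>))"
    by (simp add: haar_translation(2)[OF \<mu> \<psi>(1)])
  also have "\<dots> = (\<integral>\<xi>. \<psi> \<gamma> * \<xi> \<gamma> \<partial>\<mu>)"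
    by (rule integral_distr[OF haar_translation(1)[OF \<mu> \<psi>(1)] measurable_evaluation[OF \<mu>]])
  also have "\<dots> = \<psi> \<gamma> * (\<integral>\<xi>. \<xi> \<gamma> \<partial>\<mu>)" by simp
  finally have "(1 - \<psi> \<gamma>) * (\<integral>\<xi>. \<xi> \<gamma> \<partial>\<mu>) = 0" by (simp add: left_diff_distrib)
  then show ?thesis using \<psi>(2) False by auto
qed

section \<open>Fourier transform of one vector-valued function\<close>

lemma borel_measurable_scaleC [measurable]:
  fixes q :: "'c \<Rightarrow> 'z::fd_complex_hilbert"
  assumes "c \<in> borel_measurable M" "q \<in> borel_measurable M"
  shows "(\<lambda>\<xi>. c \<xi> *\<^sub>C q \<xi>) \<in> borel_measurable M"
  using assms by (rule borel_measurable_continuous_Pair) (intro continuous_intros)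

definition square_integrable :: "'c measure \<Rightarrow> ('c \<Rightarrow> 'z::fd_complex_hilbert) \<Rightarrow> bool" where
  "square_integrable M q \<longleftrightarrow> q \<in> borel_measurable M \<and> integrable M (\<lambda>\<xi>. (norm (q \<xi>))\<^sup>2)"

definition trig_sum ::
  "'g set \<Rightarrow> ('g \<Rightarrow> 'z::fd_complex_hilbert) \<Rightarrow> ('g \<Rightarrow> complex) \<Rightarrow> 'z" where
  "trig_sum A u \<xi> = (\<Sum>\<gamma>\<in>A. cnj (\<xi> \<gamma>) *\<^sub>C u \<gamma>)"

text \<open>
  A relation between one vector-valued function on the group and one representative of its
  transform: the Fourier transform of the factorisation, restricted to a single coordinate.
\<close>

definition has_fourier ::
  "('g \<Rightarrow> complex) measure \<Rightarrow> ('g \<Rightarrow> 'z::fd_complex_hilbert) \<Rightarrow> (('g \<Rightarrow> complex) \<Rightarrow> 'z) \<Rightarrow> bool" where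
  "has_fourier \<mu> u q \<longleftrightarrow> square_integrable \<mu> q \<and>
     ((\<lambda>A. \<integral>\<xi>. (norm (q \<xi> - trig_sum A u \<xi>))\<^sup>2 \<partial>\<mu>) \<longlongrightarrow> 0) (finite_subsets_at_top UNIV)"

lemma norm_diff_square_le: "(norm (x - y :: 'z::real_normed_vector))\<^sup>2 \<le> 2 * (norm x)\<^sup>2 + 2 * (norm y)\<^sup>2"
proof -
  have "(norm (x - y))\<^sup>2 \<le> (norm x + norm y)\<^sup>2"
    by (intro power_mono norm_triangle_ineq4) auto
  also have "\<dots> \<le> 2 * (norm x)\<^sup>2 + 2 * (norm y)\<^sup>2"
    using sum_squares_bound[of "norm x" "norm y"] by (simp add: power2_sum)
  finally show ?thesis .
qed

lemma square_integrable_diff: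
  assumes p: "square_integrable M p" and q: "square_integrable M q"
  shows "square_integrable M (\<lambda>\<xi>. p \<xi> - q \<xi>)"
    and "(\<integral>\<xi>. (norm (p \<xi> - q \<xi>))\<^sup>2 \<partial>M) \<le> 2 * (\<integral>\<xi>. (norm (p \<xi>))\<^sup>2 \<partial>M) + 2 * (\<integral>\<xi>. (norm (q \<xi>))\<^sup>2 \<partial>M)"
proof -
  have [measurable]: "p \<in> borel_measurable M" "q \<in> borel_measurable M"
    using p q by (auto simp: square_integrable_def)
  have int: "integrable M (\<lambda>\<xi>. 2 * (norm (p \<xi>))\<^sup>2 + 2 * (norm (q \<xi>))\<^sup>2)"
    using p q by (auto simp: square_integrable_def)
  have int': "integrable M (\<lambda>\<xi>. (norm (p \<xi> - q \<xi>))\<^sup>2)"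
    by (rule Bochner_Integration.integrable_bound[OF int]) (auto intro!: norm_diff_square_le)
  then show "square_integrable M (\<lambda>\<xi>. p \<xi> - q \<xi>)" by (simp add: square_integrable_def)
  have "(\<integral>\<xi>. (norm (p \<xi> - q \<xi>))\<^sup>2 \<partial>M) \<le> (\<integral>\<xi>. 2 * (norm (p \<xi>))\<^sup>2 + 2 * (norm (q \<xi>))\<^sup>2 \<partial>M)"
    by (intro integral_mono int int' norm_diff_square_le)
  also have "\<dots> = 2 * (\<integral>\<xi>. (norm (p \<xi>))\<^sup>2 \<partial>M) + 2 * (\<integral>\<xi>. (norm (q \<xi>))\<^sup>2 \<partial>M)"
    using p q by (simp add: square_integrable_def)
  finally show "(\<integral>\<xi>. (norm (p \<xi> - q \<xi>))\<^sup>2 \<partial>M) \<le> 2 * (\<integral>\<xi>. (norm (p \<xi>))\<^sup>2 \<partial>M) + 2 * (\<integral>\<xi>. (norm (q \<xi>))\<^sup>2 \<partial>M)" .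
qed

lemma square_integrable_clinear:
  assumes L: "clinear L"
  shows "square_integrable M q \<Longrightarrow> square_integrable M (\<lambda>\<xi>. L (q \<xi>))"
    and "\<exists>K. \<forall>q. square_integrable M q \<longrightarrow>
      (\<integral>\<xi>. (norm (L (q \<xi>)))\<^sup>2 \<partial>M) \<le> K * (\<integral>\<xi>. (norm (q \<xi>))\<^sup>2 \<partial>M)"
proof -
  have bl: "bounded_linear L" by (rule clinear_imp_bounded_linear[OF L])
  obtain K where K: "\<And>x. norm (L x) \<le> norm x * K" using bounded_linear.bounded[OF bl] by blast
  have le: "(norm (L x))\<^sup>2 \<le> K\<^sup>2 * (norm x)\<^sup>2" for x
    using power_mono[OF K[of x], of 2] by (simp add: power_mult_distrib mult.commute)
  have si: "square_integrable M (\<lambda>\<xi>. L (q \<xi>))" if "square_integrable M q" for q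
  proof -
    have [measurable]: "q \<in> borel_measurable M" using that by (simp add: square_integrable_def)
    have Lq [measurable]: "(\<lambda>\<xi>. L (q \<xi>)) \<in> borel_measurable M"
      by (rule borel_measurable_continuous_on[OF linear_continuous_on[OF bl]]) simp
    have "integrable M (\<lambda>\<xi>. K\<^sup>2 * (norm (q \<xi>))\<^sup>2)" using that by (simp add: square_integrable_def)
    then have "integrable M (\<lambda>\<xi>. (norm (L (q \<xi>)))\<^sup>2)"
      by (rule Bochner_Integration.integrable_bound) (use le in auto)
    with Lq show ?thesis by (simp add: square_integrable_def)
  qed
  show "square_integrable M q \<Longrightarrow> square_integrable M (\<lambda>\<xi>. L (q \<xi>))" by (rule si)
  have "(\<integral>\<xi>. (norm (L (q \<xi>)))\<^sup>2 \<partial>M) \<le> K\<^sup>2 * (\<integral>\<xi>. (norm (q \<xi>))\<^sup>2 \<partial>M)"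
    if q: "square_integrable M q" for q
  proof -
    have "(\<integral>\<xi>. (norm (L (q \<xi>)))\<^sup>2 \<partial>M) \<le> (\<integral>\<xi>. K\<^sup>2 * (norm (q \<xi>))\<^sup>2 \<partial>M)"
      using q si[OF q] by (intro integral_mono le) (auto simp: square_integrable_def)
    then show ?thesis by simp
  qed
  then show "\<exists>K. \<forall>q. square_integrable M q \<longrightarrow>
      (\<integral>\<xi>. (norm (L (q \<xi>)))\<^sup>2 \<partial>M) \<le> K * (\<integral>\<xi>. (norm (q \<xi>))\<^sup>2 \<partial>M)" by blast
qed

text \<open>
  Expanding the squared norm gives a double sum of terms \<open>\<xi> (\<delta> - \<gamma>)\<close> times \<open>cinner (u \<gamma>) (u \<delta>)\<close>, and
  integration keeps the diagonal.
\<close>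

lemma trig_sum_parseval:
  fixes \<mu> :: "('g::ab_group_add \<Rightarrow> complex) measure" and u :: "'g \<Rightarrow> 'z::fd_complex_hilbert"
  assumes \<mu>: "haar_probability \<mu>"
  shows "square_integrable \<mu> (trig_sum A u)"
    and "(\<integral>\<xi>. (norm (trig_sum A u \<xi>))\<^sup>2 \<partial>\<mu>) = (\<Sum>\<gamma>\<in>A. (norm (u \<gamma>))\<^sup>2)"
proof -
  interpret prob_space \<mu> using \<mu> by (simp add: haar_probability_def)
  note [measurable] = measurable_evaluation[OF \<mu>]
  have int: "integrable \<mu> (\<lambda>\<xi>. \<xi> \<gamma>)" for \<gamma>
    by (rule integrable_const_bound[of _ 1])
       (auto intro!: AE_I2 simp: haar_space[OF \<mu>] dual_groupD(2) measurable_evaluation[OF \<mu>])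
  have int2: "integrable \<mu> (\<lambda>\<xi>. Re (\<xi> \<gamma> * c))" for \<gamma> c
    by (intro integrable_Re integrable_mult_left int)
  have expand: "(norm (trig_sum A u \<xi>))\<^sup>2 = (\<Sum>\<gamma>\<in>A. \<Sum>\<delta>\<in>A. Re (\<xi> (\<delta> - \<gamma>) * cinner (u \<gamma>) (u \<delta>)))"
    if "\<xi> \<in> space \<mu>" for \<xi>
  proof -
    have \<xi>: "\<xi> \<in> dual_group" using that haar_space[OF \<mu>] by simp
    have "complex_of_real ((norm (trig_sum A u \<xi>))\<^sup>2) =
        (\<Sum>\<gamma>\<in>A. \<Sum>\<delta>\<in>A. \<xi> (\<delta> - \<gamma>) * cinner (u \<gamma>) (u \<delta>))"
      unfolding cinner_self[symmetric] trig_sum_def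
      by (simp add: cinner_sum_left cinner_sum_right cinner_scaleC_left cinner_scaleC_right
          sum_distrib_left dual_groupD(1)[OF \<xi>, of _ "- _", simplified] dual_groupD(4)[OF \<xi>] mult_ac)
         (rule sum.swap)
    then show ?thesis
      by (metis (no_types, lifting) Re_complex_of_real Re_sum sum.cong)
  qed
  have meas: "trig_sum A u \<in> borel_measurable \<mu>"
    unfolding trig_sum_def
    by (intro borel_measurable_sum borel_measurable_scaleC borel_measurable_const
        borel_measurable_continuous_on[OF _ measurable_evaluation[OF \<mu>]] continuous_intros)
  have "integrable \<mu> (\<lambda>\<xi>. (norm (trig_sum A u \<xi>))\<^sup>2)"
    by (subst Bochner_Integration.integrable_cong[OF refl expand])
       (assumption | intro Bochner_Integration.integrable_sum int2)+
  with meas show "square_integrable \<mu> (trig_sum A u)" by (simp add: square_integrable_def)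
  have "(\<integral>\<xi>. (norm (trig_sum A u \<xi>))\<^sup>2 \<partial>\<mu>) =
      (\<integral>\<xi>. (\<Sum>\<gamma>\<in>A. \<Sum>\<delta>\<in>A. Re (\<xi> (\<delta> - \<gamma>) * cinner (u \<gamma>) (u \<delta>))) \<partial>\<mu>)"
    by (rule Bochner_Integration.integral_cong[OF refl expand])
  also have "\<dots> = (\<Sum>\<gamma>\<in>A. \<Sum>\<delta>\<in>A. \<integral>\<xi>. Re (\<xi> (\<delta> - \<gamma>) * cinner (u \<gamma>) (u \<delta>)) \<partial>\<mu>)"
    by (subst Bochner_Integration.integral_sum, intro Bochner_Integration.integrable_sum int2)
       (intro sum.cong refl Bochner_Integration.integral_sum int2)
  also have "\<dots> = (\<Sum>\<gamma>\<in>A. \<Sum>\<delta>\<in>A. if \<gamma> = \<delta> then (norm (u \<gamma>))\<^sup>2 else 0)"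
  proof (intro sum.cong refl)
    fix \<gamma> \<delta>
    have "(\<integral>\<xi>. Re (\<xi> (\<delta> - \<gamma>) * cinner (u \<gamma>) (u \<delta>)) \<partial>\<mu>) =
        Re ((\<integral>\<xi>. \<xi> (\<delta> - \<gamma>) \<partial>\<mu>) * cinner (u \<gamma>) (u \<delta>))"
      by (subst integral_Re) (auto intro!: integrable_mult_left int)
    then show "(\<integral>\<xi>. Re (\<xi> (\<delta> - \<gamma>) * cinner (u \<gamma>) (u \<delta>)) \<partial>\<mu>) =
        (if \<gamma> = \<delta> then (norm (u \<gamma>))\<^sup>2 else 0)"
      by (simp add: integral_character[OF \<mu>] cinner_self)
  qed
  also have "\<dots> = (\<Sum>\<gamma>\<in>A. (norm (u \<gamma>))\<^sup>2)"
    by (cases "finite A") (simp_all add: sum.delta)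
  finally show "(\<integral>\<xi>. (norm (trig_sum A u \<xi>))\<^sup>2 \<partial>\<mu>) = (\<Sum>\<gamma>\<in>A. (norm (u \<gamma>))\<^sup>2)" .
qed

lemma trig_sum_distance:
  fixes \<mu> :: "('g::ab_group_add \<Rightarrow> complex) measure" and u :: "'g \<Rightarrow> 'z::fd_complex_hilbert"
  assumes \<mu>: "haar_probability \<mu>" and AB: "finite A" "finite B"
  shows "(\<integral>\<xi>. (norm (trig_sum A u \<xi> - trig_sum B u \<xi>))\<^sup>2 \<partial>\<mu>) =
    (\<Sum>\<gamma>\<in>(A - B) \<union> (B - A). (norm (u \<gamma>))\<^sup>2)"
proof -
  define v where "v \<gamma> = (if \<gamma> \<in> A then u \<gamma> else 0) - (if \<gamma> \<in> B then u \<gamma> else 0)" for \<gamma>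
  have ext: "trig_sum X u \<xi> = (\<Sum>\<gamma>\<in>A \<union> B. cnj (\<xi> \<gamma>) *\<^sub>C (if \<gamma> \<in> X then u \<gamma> else 0))"
    if "X \<subseteq> A \<union> B" for X \<xi>
    unfolding trig_sum_def
    by (rule sum.mono_neutral_cong_left) (use AB that in \<open>auto simp: scaleC_zero_right\<close>)
  have "trig_sum A u \<xi> - trig_sum B u \<xi> = trig_sum (A \<union> B) v \<xi>" for \<xi>
    unfolding ext[OF Un_upper1] ext[OF Un_upper2]
    by (simp only: trig_sum_def v_def scaleC_diff_right sum_subtractf)
  then have "(\<integral>\<xi>. (norm (trig_sum A u \<xi> - trig_sum B u \<xi>))\<^sup>2 \<partial>\<mu>) = (\<Sum>\<gamma>\<in>A \<union> B. (norm (v \<gamma>))\<^sup>2)"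
    by (simp add: trig_sum_parseval(2)[OF \<mu>])
  also have "\<dots> = (\<Sum>\<gamma>\<in>(A - B) \<union> (B - A). (norm (u \<gamma>))\<^sup>2)"
    by (rule sum.mono_neutral_cong_right) (use AB in \<open>auto simp: v_def\<close>)
  finally show ?thesis .
qed

lemma has_fourier_clinear:
  fixes \<mu> :: "('g::ab_group_add \<Rightarrow> complex) measure"
  assumes \<mu>: "haar_probability \<mu>" and L: "clinear L" and u: "has_fourier \<mu> u q"
  shows "has_fourier \<mu> (\<lambda>\<gamma>. L (u \<gamma>)) (\<lambda>\<xi>. L (q \<xi>))"
proof -
  have q: "square_integrable \<mu> q"
    and lim: "((\<lambda>A. \<integral>\<xi>. (norm (q \<xi> - trig_sum A u \<xi>))\<^sup>2 \<partial>\<mu>) \<longlongrightarrow> 0) (finite_subsets_at_top UNIV)"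
    using u by (auto simp: has_fourier_def)
  obtain K where K: "\<And>q. square_integrable \<mu> q \<Longrightarrow>
      (\<integral>\<xi>. (norm (L (q \<xi>)))\<^sup>2 \<partial>\<mu>) \<le> K * (\<integral>\<xi>. (norm (q \<xi>))\<^sup>2 \<partial>\<mu>)"
    using square_integrable_clinear(2)[OF L] by blast
  have eq: "L (q \<xi>) - trig_sum A (\<lambda>\<gamma>. L (u \<gamma>)) \<xi> = L (q \<xi> - trig_sum A u \<xi>)" for A \<xi>
    by (simp add: trig_sum_def clinear_diff[OF L] clinear_sum[OF L] clinear_scaleC[OF L])
  have "((\<lambda>A. \<integral>\<xi>. (norm (L (q \<xi>) - trig_sum A (\<lambda>\<gamma>. L (u \<gamma>)) \<xi>))\<^sup>2 \<partial>\<mu>) \<longlongrightarrow> 0) (finite_subsets_at_top UNIV)"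
  proof (rule tendsto_sandwich[where f = "\<lambda>_. 0"])
    show "\<forall>\<^sub>F A in finite_subsets_at_top UNIV.
        (\<integral>\<xi>. (norm (L (q \<xi>) - trig_sum A (\<lambda>\<gamma>. L (u \<gamma>)) \<xi>))\<^sup>2 \<partial>\<mu>)
        \<le> K * (\<integral>\<xi>. (norm (q \<xi> - trig_sum A u \<xi>))\<^sup>2 \<partial>\<mu>)"
      unfolding eq by (intro always_eventually allI K square_integrable_diff q trig_sum_parseval \<mu>)
    show "((\<lambda>A. K * (\<integral>\<xi>. (norm (q \<xi> - trig_sum A u \<xi>))\<^sup>2 \<partial>\<mu>)) \<longlongrightarrow> 0) (finite_subsets_at_top UNIV)"
      using tendsto_mult_left[OF lim, of K] by simp
  qed auto
  then show ?thesis using square_integrable_clinear(1)[OF L q] by (simp add: has_fourier_def)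
qed

lemma has_fourier_diff:
  fixes \<mu> :: "('g::ab_group_add \<Rightarrow> complex) measure"
  assumes \<mu>: "haar_probability \<mu>" and u: "has_fourier \<mu> u q" and v: "has_fourier \<mu> v r"
  shows "has_fourier \<mu> (\<lambda>\<gamma>. u \<gamma> - v \<gamma>) (\<lambda>\<xi>. q \<xi> - r \<xi>)"
proof -
  let ?D = "\<lambda>u q A. \<integral>\<xi>. (norm (q \<xi> - trig_sum A u \<xi>))\<^sup>2 \<partial>\<mu>"
  have q: "square_integrable \<mu> q" and r: "square_integrable \<mu> r"
    and lim: "(?D u q \<longlongrightarrow> 0) (finite_subsets_at_top UNIV)" "(?D v r \<longlongrightarrow> 0) (finite_subsets_at_top UNIV)"
    using u v by (auto simp: has_fourier_def)
  have eq: "(q \<xi> - r \<xi>) - trig_sum A (\<lambda>\<gamma>. u \<gamma> - v \<gamma>) \<xi> =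
      (q \<xi> - trig_sum A u \<xi>) - (r \<xi> - trig_sum A v \<xi>)" for A \<xi>
    by (simp add: trig_sum_def scaleC_diff_right sum_subtractf)
  have "(?D (\<lambda>\<gamma>. u \<gamma> - v \<gamma>) (\<lambda>\<xi>. q \<xi> - r \<xi>) \<longlongrightarrow> 0) (finite_subsets_at_top UNIV)"
  proof (rule tendsto_sandwich[where f = "\<lambda>_. 0"])
    show "\<forall>\<^sub>F A in finite_subsets_at_top UNIV.
        ?D (\<lambda>\<gamma>. u \<gamma> - v \<gamma>) (\<lambda>\<xi>. q \<xi> - r \<xi>) A \<le> 2 * ?D u q A + 2 * ?D v r A"
      unfolding eq by (intro always_eventually allI square_integrable_diff q r trig_sum_parseval \<mu>)
    show "((\<lambda>A. 2 * ?D u q A + 2 * ?D v r A) \<longlongrightarrow> 0) (finite_subsets_at_top UNIV)"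
      using tendsto_add[OF tendsto_mult_left[OF lim(1), of 2] tendsto_mult_left[OF lim(2), of 2]] by simp
  qed auto
  then show ?thesis using square_integrable_diff(1)[OF q r] by (simp add: has_fourier_def)
qed

text \<open>
  Up to the unimodular factor \<open>\<xi> s\<close>, the partial sum of the translated function over \<open>A\<close> is the
  partial sum of \<open>u\<close> over \<open>A + s\<close>, and \<open>A \<mapsto> A + s\<close> preserves the limit over finite subsets.
\<close>

lemma has_fourier_translate:
  fixes \<mu> :: "('g::ab_group_add \<Rightarrow> complex) measure"
  assumes \<mu>: "haar_probability \<mu>" and u: "has_fourier \<mu> u q"
  shows "has_fourier \<mu> (\<lambda>\<gamma>. u (\<gamma> + s)) (\<lambda>\<xi>. \<xi> s *\<^sub>C q \<xi>)"
proof -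
  note [measurable] = measurable_evaluation[OF \<mu>]
  have [measurable]: "q \<in> borel_measurable \<mu>" and int: "integrable \<mu> (\<lambda>\<xi>. (norm (q \<xi>))\<^sup>2)"
    and lim: "((\<lambda>A. \<integral>\<xi>. (norm (q \<xi> - trig_sum A u \<xi>))\<^sup>2 \<partial>\<mu>) \<longlongrightarrow> 0) (finite_subsets_at_top UNIV)"
    using u by (auto simp: has_fourier_def square_integrable_def)
  have "integrable \<mu> (\<lambda>\<xi>. (norm (\<xi> s *\<^sub>C q \<xi>))\<^sup>2)"
    by (subst Bochner_Integration.integrable_cong[OF refl, where g="\<lambda>\<xi>. (norm (q \<xi>))\<^sup>2"])
       (auto simp: haar_space[OF \<mu>] norm_scaleC dual_groupD(2) int)
  then have si: "square_integrable \<mu> (\<lambda>\<xi>. \<xi> s *\<^sub>C q \<xi>)" by (simp add: square_integrable_def)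
  have eq: "(\<integral>\<xi>. (norm (\<xi> s *\<^sub>C q \<xi> - trig_sum A (\<lambda>\<gamma>. u (\<gamma> + s)) \<xi>))\<^sup>2 \<partial>\<mu>) =
      (\<integral>\<xi>. (norm (q \<xi> - trig_sum ((\<lambda>\<gamma>. \<gamma> + s) ` A) u \<xi>))\<^sup>2 \<partial>\<mu>)" for A
  proof (intro Bochner_Integration.integral_cong refl)
    fix \<xi> assume "\<xi> \<in> space \<mu>"
    then have \<xi>: "\<xi> \<in> dual_group" using haar_space[OF \<mu>] by simp
    have "\<xi> s * cnj (\<xi> (\<gamma> + s)) = cnj (\<xi> \<gamma>)" for \<gamma>
      using dual_groupD(5)[OF \<xi>, of s] by (simp add: dual_groupD(1)[OF \<xi>])
    then have "trig_sum A (\<lambda>\<gamma>. u (\<gamma> + s)) \<xi> = \<xi> s *\<^sub>C trig_sum ((\<lambda>\<gamma>. \<gamma> + s) ` A) u \<xi>"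
      unfolding trig_sum_def by (subst sum.reindex) (auto simp: inj_on_def scaleC_sum_right scaleC_scaleC)
    then show "(norm (\<xi> s *\<^sub>C q \<xi> - trig_sum A (\<lambda>\<gamma>. u (\<gamma> + s)) \<xi>))\<^sup>2 =
        (norm (q \<xi> - trig_sum ((\<lambda>\<gamma>. \<gamma> + s) ` A) u \<xi>))\<^sup>2"
      by (simp add: norm_scaleC dual_groupD(2)[OF \<xi>] flip: scaleC_diff_right)
  qed
  have "filterlim ((`) (\<lambda>\<gamma>. \<gamma> + s)) (finite_subsets_at_top UNIV) (finite_subsets_at_top UNIV)"
    unfolding filterlim_finite_subsets_at_top
  proof (intro allI impI)
    fix X :: "'g set" assume X: "finite X \<and> X \<subseteq> UNIV"
    show "\<forall>\<^sub>F A in finite_subsets_at_top UNIV. finite ((\<lambda>\<gamma>. \<gamma> + s) ` A) \<and>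
        X \<subseteq> (\<lambda>\<gamma>. \<gamma> + s) ` A \<and> (\<lambda>\<gamma>. \<gamma> + s) ` A \<subseteq> UNIV"
      unfolding eventually_finite_subsets_at_top
    proof (intro exI[of _ "(\<lambda>\<gamma>. \<gamma> - s) ` X"] conjI allI impI)
      fix A assume A: "finite A \<and> (\<lambda>\<gamma>. \<gamma> - s) ` X \<subseteq> A \<and> A \<subseteq> UNIV"
      then show "X \<subseteq> (\<lambda>\<gamma>. \<gamma> + s) ` A" by (force simp: image_iff)
    qed (use X in auto)
  qed
  from filterlim_compose[OF lim this]
  have "((\<lambda>A. \<integral>\<xi>. (norm (\<xi> s *\<^sub>C q \<xi> - trig_sum A (\<lambda>\<gamma>. u (\<gamma> + s)) \<xi>))\<^sup>2 \<partial>\<mu>) \<longlongrightarrow> 0)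
      (finite_subsets_at_top UNIV)" unfolding eq .
  with si show ?thesis by (simp add: has_fourier_def)
qed

lemma has_fourier_AE_cong:
  fixes \<mu> :: "('g::ab_group_add \<Rightarrow> complex) measure"
  assumes \<mu>: "haar_probability \<mu>" and u: "has_fourier \<mu> u q" and r: "r \<in> borel_measurable \<mu>"
    and ae: "AE \<xi> in \<mu>. q \<xi> = r \<xi>"
  shows "has_fourier \<mu> u r"
proof -
  have [measurable]: "q \<in> borel_measurable \<mu>" "r \<in> borel_measurable \<mu>" "trig_sum A u \<in> borel_measurable \<mu>" for A
    using u r trig_sum_parseval(1)[OF \<mu>, of A u] by (auto simp: has_fourier_def square_integrable_def)
  have "(\<integral>\<xi>. (norm (q \<xi> - trig_sum A u \<xi>))\<^sup>2 \<partial>\<mu>) = (\<integral>\<xi>. (norm (r \<xi> - trig_sum A u \<xi>))\<^sup>2 \<partial>\<mu>)" for A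
    by (rule integral_cong_AE) (use ae in auto)
  moreover have "integrable \<mu> (\<lambda>\<xi>. (norm (r \<xi>))\<^sup>2)"
    by (rule integrable_cong_AE_imp[of _ "\<lambda>\<xi>. (norm (q \<xi>))\<^sup>2"])
       (use u ae in \<open>auto simp: has_fourier_def square_integrable_def\<close>)
  ultimately show ?thesis using u r by (simp add: has_fourier_def square_integrable_def)
qed

lemma has_fourier_unique:
  fixes \<mu> :: "('g::ab_group_add \<Rightarrow> complex) measure"
  assumes \<mu>: "haar_probability \<mu>" and q: "has_fourier \<mu> u q" and r: "has_fourier \<mu> u r"
  shows "AE \<xi> in \<mu>. q \<xi> = r \<xi>"
proof -
  have "has_fourier \<mu> (\<lambda>\<gamma>. u \<gamma> - u \<gamma>) (\<lambda>\<xi>. q \<xi> - r \<xi>)" by (rule has_fourier_diff[OF \<mu> q r])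
  then have si: "square_integrable \<mu> (\<lambda>\<xi>. q \<xi> - r \<xi>)"
    and lim: "((\<lambda>A::'g set. \<integral>\<xi>. (norm (q \<xi> - r \<xi>))\<^sup>2 \<partial>\<mu>) \<longlongrightarrow> 0) (finite_subsets_at_top UNIV)"
    by (auto simp: has_fourier_def trig_sum_def scaleC_zero_right)
  have "(\<integral>\<xi>. (norm (q \<xi> - r \<xi>))\<^sup>2 \<partial>\<mu>) = 0"
    by (rule tendsto_unique[OF _ tendsto_const lim]) simp
  then have "AE \<xi> in \<mu>. (norm (q \<xi> - r \<xi>))\<^sup>2 = 0"
    using si by (subst (asm) integral_nonneg_eq_0_iff_AE) (auto simp: square_integrable_def)
  then show ?thesis by simp
qed

text \<open>
  The difference has transform 0, so by Parseval its finite sums of squares, which increase,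
  tend to 0.
\<close>

lemma has_fourier_injective:
  fixes \<mu> :: "('g::ab_group_add \<Rightarrow> complex) measure"
  assumes \<mu>: "haar_probability \<mu>" and u: "has_fourier \<mu> u q" and v: "has_fourier \<mu> v q"
  shows "u = v"
proof
  fix \<gamma>0
  let ?w = "\<lambda>\<gamma>. u \<gamma> - v \<gamma>"
  have "has_fourier \<mu> ?w (\<lambda>\<xi>. q \<xi> - q \<xi>)" by (rule has_fourier_diff[OF \<mu> u v])
  then have lim: "((\<lambda>A. \<Sum>\<gamma>\<in>A. (norm (?w \<gamma>))\<^sup>2) \<longlongrightarrow> 0) (finite_subsets_at_top UNIV)"
    by (simp add: has_fourier_def trig_sum_parseval(2)[OF \<mu>])
  have "(norm (?w \<gamma>0))\<^sup>2 \<le> 0"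
  proof (rule tendsto_lowerbound[OF lim])
    show "\<forall>\<^sub>F A in finite_subsets_at_top UNIV. (norm (?w \<gamma>0))\<^sup>2 \<le> (\<Sum>\<gamma>\<in>A. (norm (?w \<gamma>))\<^sup>2)"
      unfolding eventually_finite_subsets_at_top
      by (intro exI[of _ "{\<gamma>0}"] conjI allI impI member_le_sum) auto
  qed simp
  then show "u \<gamma>0 = v \<gamma>0" by simp
qed

lemma square_summable_tail:
  fixes u :: "'g \<Rightarrow> 'z::real_normed_vector"
  assumes u: "(\<lambda>\<gamma>. (norm (u \<gamma>))\<^sup>2) summable_on UNIV" and "e > 0"
  shows "\<exists>A. finite A \<and> (\<forall>F. finite F \<and> F \<inter> A = {} \<longrightarrow> (\<Sum>\<gamma>\<in>F. (norm (u \<gamma>))\<^sup>2) \<le> e)"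
proof -
  let ?S = "\<Sum>\<^sub>\<infinity>\<gamma>. (norm (u \<gamma>))\<^sup>2"
  have "((\<lambda>A. \<Sum>\<gamma>\<in>A. (norm (u \<gamma>))\<^sup>2) \<longlongrightarrow> ?S) (finite_subsets_at_top UNIV)"
    using has_sum_infsum[OF u] by (simp add: has_sum_def)
  then have "\<forall>\<^sub>F A in finite_subsets_at_top UNIV. ?S - e < (\<Sum>\<gamma>\<in>A. (norm (u \<gamma>))\<^sup>2)"
    using \<open>e > 0\<close> by (intro order_tendstoD) auto
  then obtain A where A: "finite A" "?S - e < (\<Sum>\<gamma>\<in>A. (norm (u \<gamma>))\<^sup>2)"
    unfolding eventually_finite_subsets_at_top by blast
  have "(\<Sum>\<gamma>\<in>F. (norm (u \<gamma>))\<^sup>2) \<le> e" if "finite F" "F \<inter> A = {}" for F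
  proof -
    have "(\<Sum>\<gamma>\<in>F. (norm (u \<gamma>))\<^sup>2) + (\<Sum>\<gamma>\<in>A. (norm (u \<gamma>))\<^sup>2) = (\<Sum>\<gamma>\<in>F \<union> A. (norm (u \<gamma>))\<^sup>2)"
      using that A(1) by (simp add: sum.union_disjoint)
    also have "\<dots> \<le> ?S" using that A(1) by (intro finite_sum_le_infsum u) auto
    finally show ?thesis using A(2) by simp
  qed
  then show ?thesis using A(1) by blast
qed

text \<open>
  The increments have squared \<open>L\<^sup>2\<close> norms at most \<open>4\<^sup>-\<^sup>n\<close>, so even after weighting with \<open>2\<^sup>n\<close> their
  squares have an integrable sum. Where that sum is finite, the increments themselves are
  absolutely summable.
\<close>

lemma AE_convergent_if_fast_Cauchy:
  fixes p :: "nat \<Rightarrow> 'c \<Rightarrow> 'z::fd_complex_hilbert"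
  assumes si: "\<And>n. square_integrable M (p n)"
    and le: "\<And>n. (\<integral>\<xi>. (norm (p (Suc n) \<xi> - p n \<xi>))\<^sup>2 \<partial>M) \<le> (1 / 4) ^ n"
  shows "AE \<xi> in M. convergent (\<lambda>n. p n \<xi>)"
proof -
  have [measurable]: "p n \<in> borel_measurable M" for n using si by (simp add: square_integrable_def)
  let ?d = "\<lambda>n \<xi>. 2 ^ n * (norm (p (Suc n) \<xi> - p n \<xi>))\<^sup>2"
  have "(\<integral>\<^sup>+\<xi>. (\<Sum>n. ennreal (?d n \<xi>)) \<partial>M) = (\<Sum>n. \<integral>\<^sup>+\<xi>. ennreal (?d n \<xi>) \<partial>M)"
    by (rule nn_integral_suminf) measurable
  also have "\<dots> \<le> (\<Sum>n. ennreal ((1 / 2) ^ n))"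
  proof (intro suminf_le)
    fix n
    have int: "integrable M (\<lambda>\<xi>. (norm (p (Suc n) \<xi> - p n \<xi>))\<^sup>2)"
      using square_integrable_diff(1)[OF si si] by (simp add: square_integrable_def)
    have "(\<integral>\<^sup>+\<xi>. ennreal (?d n \<xi>) \<partial>M) = ennreal (\<integral>\<xi>. ?d n \<xi> \<partial>M)"
      using int by (intro nn_integral_eq_integral integrable_mult_right) auto
    also have "(\<integral>\<xi>. ?d n \<xi> \<partial>M) \<le> 2 ^ n * (1 / 4) ^ n"
      using le[of n] by simp
    also have "2 ^ n * (1 / 4) ^ n = ((1 / 2) ^ n :: real)" by (simp flip: power_mult_distrib)
    finally show "(\<integral>\<^sup>+\<xi>. ennreal (?d n \<xi>) \<partial>M) \<le> ennreal ((1 / 2) ^ n)" by (simp add: ennreal_leI)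
  qed auto
  also have "\<dots> = ennreal (\<Sum>n. (1 / 2) ^ n)"
    by (intro suminf_ennreal2 summable_geometric) auto
  finally have "(\<integral>\<^sup>+\<xi>. (\<Sum>n. ennreal (?d n \<xi>)) \<partial>M) \<noteq> \<infinity>"
    by (auto simp: top_unique)
  then have "AE \<xi> in M. (\<Sum>n. ennreal (?d n \<xi>)) \<noteq> \<infinity>"
    by (intro nn_integral_noteq_infinite) auto
  then show ?thesis
  proof eventually_elim
    case (elim \<xi>)
    have "summable (\<lambda>n. ?d n \<xi>)"
      by (rule summable_suminf_not_top) (use elim in auto)
    then have "summable (\<lambda>n. ?d n \<xi> + (1 / 2) ^ n)"
      by (intro summable_add summable_geometric) auto
    moreover have "norm (p (Suc n) \<xi> - p n \<xi>) \<le> ?d n \<xi> + (1 / 2) ^ n" for n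
    proof -
      (* The mean inequality t \<le> 2^n t^2 + 2^(-n). *)
      define t where "t = norm (p (Suc n) \<xi> - p n \<xi>)"
      have t: "t \<ge> 0" by (simp add: t_def)
      have "0 \<le> (2 ^ n * t - 1)\<^sup>2" by simp
      also have "(2 ^ n * t - 1)\<^sup>2 = 2 ^ n * (2 ^ n * t\<^sup>2 - t + (1 / 2) ^ n) - 2 ^ n * t"
        by (simp add: power2_eq_square algebra_simps flip: power_mult_distrib)
      finally have "2 ^ n * t \<le> 2 ^ n * (2 ^ n * t\<^sup>2 - t + (1 / 2) ^ n)" by simp
      then have "t \<le> 2 ^ n * t\<^sup>2 - t + (1 / 2) ^ n" by simp
      then show ?thesis using t unfolding t_def by linarith
    qed
    ultimately have "summable (\<lambda>n. p (Suc n) \<xi> - p n \<xi>)"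
      by (rule summable_comparison_test')
    then have "convergent (\<lambda>n. \<Sum>k<n. p (Suc k) \<xi> - p k \<xi>)"
      by (simp add: summable_iff_convergent)
    then have "convergent (\<lambda>n. p n \<xi> - p 0 \<xi>)"
      by (simp only: sum_lessThan_telescope[of "\<lambda>n. p n \<xi>"])
    from convergent_add[OF this convergent_const[of "p 0 \<xi>"]] show ?case by simp
  qed
qed

lemma square_integrable_Fatou:
  fixes p :: "nat \<Rightarrow> 'c \<Rightarrow> 'z::fd_complex_hilbert"
  assumes si: "\<And>n. square_integrable M (p n)" and q: "q \<in> borel_measurable M"
    and lim: "AE \<xi> in M. (\<lambda>n. p n \<xi>) \<longlonglongrightarrow> q \<xi>"
    and le: "\<And>n. n \<ge> N \<Longrightarrow> (\<integral>\<xi>. (norm (p n \<xi>))\<^sup>2 \<partial>M) \<le> K"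
  shows "square_integrable M q" and "(\<integral>\<xi>. (norm (q \<xi>))\<^sup>2 \<partial>M) \<le> K"
proof -
  have [measurable]: "p n \<in> borel_measurable M" for n using si by (simp add: square_integrable_def)
  note [measurable] = q
  have K: "K \<ge> 0" by (rule order_trans[OF _ le[OF order_refl]]) simp
  have "(\<integral>\<^sup>+\<xi>. ennreal ((norm (q \<xi>))\<^sup>2) \<partial>M) =
      (\<integral>\<^sup>+\<xi>. liminf (\<lambda>n. ennreal ((norm (p n \<xi>))\<^sup>2)) \<partial>M)"
  proof (rule nn_integral_cong_AE)
    show "AE \<xi> in M. ennreal ((norm (q \<xi>))\<^sup>2) = liminf (\<lambda>n. ennreal ((norm (p n \<xi>))\<^sup>2))"
      using lim
    proof eventually_elim
      case (elim \<xi>)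
      then have "(\<lambda>n. ennreal ((norm (p n \<xi>))\<^sup>2)) \<longlonglongrightarrow> ennreal ((norm (q \<xi>))\<^sup>2)"
        by (intro tendsto_ennrealI tendsto_intros)
      then show ?case by (intro lim_imp_Liminf[symmetric]) simp
    qed
  qed
  also have "\<dots> \<le> liminf (\<lambda>n. \<integral>\<^sup>+\<xi>. ennreal ((norm (p n \<xi>))\<^sup>2) \<partial>M)"
    by (rule nn_integral_liminf) measurable
  also have "\<dots> \<le> liminf (\<lambda>n. ennreal K)"
  proof (rule Liminf_mono)
    have "(\<integral>\<^sup>+\<xi>. ennreal ((norm (p n \<xi>))\<^sup>2) \<partial>M) \<le> ennreal K" if "n \<ge> N" for n
      using si[of n] le[OF that]
      by (subst nn_integral_eq_integral) (auto simp: square_integrable_def ennreal_leI)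
    then show "\<forall>\<^sub>F n in sequentially. (\<integral>\<^sup>+\<xi>. ennreal ((norm (p n \<xi>))\<^sup>2) \<partial>M) \<le> ennreal K"
      unfolding eventually_sequentially by blast
  qed
  finally have nn: "(\<integral>\<^sup>+\<xi>. ennreal ((norm (q \<xi>))\<^sup>2) \<partial>M) \<le> ennreal K" by (simp add: Liminf_const)
  have int: "integrable M (\<lambda>\<xi>. (norm (q \<xi>))\<^sup>2)"
    by (rule integrableI_bounded) (use nn in \<open>auto simp: le_less_trans[OF _ ennreal_less_top]\<close>)
  then show "square_integrable M q" by (simp add: square_integrable_def q)
  have "ennreal (\<integral>\<xi>. (norm (q \<xi>))\<^sup>2 \<partial>M) \<le> ennreal K"
    using nn int by (simp add: nn_integral_eq_integral)
  then show "(\<integral>\<xi>. (norm (q \<xi>))\<^sup>2 \<partial>M) \<le> K" using K by simp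
qed

text \<open>
  Riesz-Fischer: along finite sets that exhaust the square sum at rate \<open>4\<^sup>-\<^sup>n\<close>, the trigonometric sums
  converge almost everywhere. Fatou's lemma then bounds the distance from the limit to the sum over
  any larger finite set, which gives the limit over the whole net of finite subsets.
\<close>

lemma has_fourier_exists:
  fixes \<mu> :: "('g::ab_group_add \<Rightarrow> complex) measure" and u :: "'g \<Rightarrow> 'z::fd_complex_hilbert"
  assumes \<mu>: "haar_probability \<mu>" and u: "(\<lambda>\<gamma>. (norm (u \<gamma>))\<^sup>2) summable_on UNIV"
  shows "\<exists>q. has_fourier \<mu> u q"
proof -
  have "\<exists>A. finite A \<and> (\<forall>F. finite F \<and> F \<inter> A = {} \<longrightarrow> (\<Sum>\<gamma>\<in>F. (norm (u \<gamma>))\<^sup>2) \<le> (1 / 4) ^ n)" for n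
    by (rule square_summable_tail[OF u]) simp
  then obtain a where a: "\<And>n::nat. finite (a n)"
    "\<And>n F. finite F \<Longrightarrow> F \<inter> a n = {} \<Longrightarrow> (\<Sum>\<gamma>\<in>F. (norm (u \<gamma>))\<^sup>2) \<le> (1 / 4) ^ n" by metis
  define A where "A n = (\<Union>k\<le>n. a k)" for n
  have fA: "finite (A n)" for n using a(1) by (simp add: A_def)
  have mono: "A m \<subseteq> A n" if "m \<le> n" for m n unfolding A_def using that by (intro UN_mono) auto
  have tail: "(\<Sum>\<gamma>\<in>F. (norm (u \<gamma>))\<^sup>2) \<le> (1 / 4) ^ n" if "finite F" "F \<inter> A n = {}" for F n
    using that by (intro a(2)) (auto simp: A_def)
  have dist: "(\<integral>\<xi>. (norm (trig_sum B u \<xi> - trig_sum C u \<xi>))\<^sup>2 \<partial>\<mu>) \<le> (1 / 4) ^ n"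
    if "finite B" "finite C" "A n \<subseteq> B" "A n \<subseteq> C" for B C n
    unfolding trig_sum_distance[OF \<mu> that(1,2)] by (rule tail) (use that in auto)
  define p where "p n = trig_sum (A n) u" for n
  define q where "q \<xi> = lim (\<lambda>n. p n \<xi>)" for \<xi>
  have si: "square_integrable \<mu> (trig_sum B u)" for B by (rule trig_sum_parseval(1)[OF \<mu>])
  have [measurable]: "trig_sum B u \<in> borel_measurable \<mu>" for B
    using si by (simp add: square_integrable_def)
  have [measurable]: "p n \<in> borel_measurable \<mu>" for n by (simp add: p_def)
  have q [measurable]: "q \<in> borel_measurable \<mu>"
    unfolding q_def by (rule borel_measurable_lim_metric) measurable
  have "AE \<xi> in \<mu>. convergent (\<lambda>n. p n \<xi>)"
  proof (rule AE_convergent_if_fast_Cauchy)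
    show "square_integrable \<mu> (p n)" for n unfolding p_def by (rule si)
    show "(\<integral>\<xi>. (norm (p (Suc n) \<xi> - p n \<xi>))\<^sup>2 \<partial>\<mu>) \<le> (1 / 4) ^ n" for n
      unfolding p_def by (intro dist fA mono) auto
  qed
  then have conv: "AE \<xi> in \<mu>. (\<lambda>n. p n \<xi>) \<longlonglongrightarrow> q \<xi>"
    unfolding q_def convergent_LIMSEQ_iff .
  have near: "square_integrable \<mu> (\<lambda>\<xi>. q \<xi> - trig_sum B u \<xi>)"
    "(\<integral>\<xi>. (norm (q \<xi> - trig_sum B u \<xi>))\<^sup>2 \<partial>\<mu>) \<le> (1 / 4) ^ n"
    if B: "finite B" "A n \<subseteq> B" for B n
  proof -
    have 1: "square_integrable \<mu> (\<lambda>\<xi>. p m \<xi> - trig_sum B u \<xi>)" for m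
      unfolding p_def by (intro square_integrable_diff si)
    have 2: "(\<lambda>\<xi>. q \<xi> - trig_sum B u \<xi>) \<in> borel_measurable \<mu>" by measurable
    have 3: "AE \<xi> in \<mu>. (\<lambda>m. p m \<xi> - trig_sum B u \<xi>) \<longlonglongrightarrow> q \<xi> - trig_sum B u \<xi>"
      using conv by eventually_elim (intro tendsto_intros)
    have 4: "(\<integral>\<xi>. (norm (p m \<xi> - trig_sum B u \<xi>))\<^sup>2 \<partial>\<mu>) \<le> (1 / 4) ^ n" if "n \<le> m" for m
      unfolding p_def by (intro dist fA B mono that)
    show "square_integrable \<mu> (\<lambda>\<xi>. q \<xi> - trig_sum B u \<xi>)"
      "(\<integral>\<xi>. (norm (q \<xi> - trig_sum B u \<xi>))\<^sup>2 \<partial>\<mu>) \<le> (1 / 4) ^ n"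
      by (rule square_integrable_Fatou[OF 1 2 3 4]; assumption)+
  qed
  (* The sum over A 0 is added back as a difference of two trigonometric sums, so that closure
     of square integrability under differences applies. *)
  have trig0: "trig_sum {} u \<xi> - trig_sum (A 0) u \<xi> = 0 - trig_sum (A 0) u \<xi>" for \<xi>
    by (simp add: trig_sum_def)
  have "square_integrable \<mu> (\<lambda>\<xi>. (q \<xi> - trig_sum (A 0) u \<xi>) - (trig_sum {} u \<xi> - trig_sum (A 0) u \<xi>))"
    by (intro square_integrable_diff si near(1)[OF fA order_refl])
  then have "square_integrable \<mu> q" unfolding trig0 by simp
  moreover have "((\<lambda>B. \<integral>\<xi>. (norm (q \<xi> - trig_sum B u \<xi>))\<^sup>2 \<partial>\<mu>) \<longlongrightarrow> 0) (finite_subsets_at_top UNIV)"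
  proof (rule tendstoI)
    fix e :: real assume "e > 0"
    then obtain n where n: "(1 / 4) ^ n < e" using real_arch_pow_inv[of e "1/4"] by auto
    show "\<forall>\<^sub>F B in finite_subsets_at_top UNIV.
        dist (\<integral>\<xi>. (norm (q \<xi> - trig_sum B u \<xi>))\<^sup>2 \<partial>\<mu>) 0 < e"
      unfolding eventually_finite_subsets_at_top
    proof (intro exI[of _ "A n"] conjI allI impI)
      fix B assume "finite B \<and> A n \<subseteq> B \<and> B \<subseteq> UNIV"
      then have "(\<integral>\<xi>. (norm (q \<xi> - trig_sum B u \<xi>))\<^sup>2 \<partial>\<mu>) \<le> (1 / 4) ^ n" by (intro near(2)) auto
      then show "dist (\<integral>\<xi>. (norm (q \<xi> - trig_sum B u \<xi>))\<^sup>2 \<partial>\<mu>) 0 < e" using n by simp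
    qed (use fA in auto)
  qed
  ultimately show ?thesis by (auto simp: has_fourier_def)
qed

section \<open>Fourier transform of finite families\<close>

lemma pow_norm_square: "(pow_norm I x)\<^sup>2 = (\<Sum>i\<in>I. (norm (x i))\<^sup>2)"
  by (simp add: pow_norm_def L2_set_def sum_nonneg)

lemma fourier_l1_truncation:
  assumes "finite A"
  shows "fourier_l1 (\<lambda>\<gamma>. if \<gamma> \<in> A then f \<gamma> else (\<lambda>_. 0)) \<xi> i = trig_sum A (\<lambda>\<gamma>. f \<gamma> i) \<xi>"
proof -
  have "fourier_l1 (\<lambda>\<gamma>. if \<gamma> \<in> A then f \<gamma> else (\<lambda>_. 0)) \<xi> i = (\<Sum>\<^sub>\<infinity>\<gamma>\<in>A. cnj (\<xi> \<gamma>) *\<^sub>C f \<gamma> i)"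
    unfolding fourier_l1_def by (rule infsum_cong_neutral) (auto simp: scaleC_zero_right)
  then show ?thesis using assms by (simp add: trig_sum_def)
qed

lemma L2_fun_iff:
  assumes "finite I"
  shows "g \<in> L2_fun \<mu> I \<longleftrightarrow>
    (\<forall>\<xi>\<in>space \<mu>. g \<xi> \<in> pow_space I) \<and> (\<forall>i\<in>I. square_integrable \<mu> (\<lambda>\<xi>. g \<xi> i))"
proof -
  have "integrable \<mu> (\<lambda>\<xi>. (pow_norm I (g \<xi>))\<^sup>2) \<longleftrightarrow> (\<forall>i\<in>I. integrable \<mu> (\<lambda>\<xi>. (norm (g \<xi> i))\<^sup>2))"
    if meas: "\<And>i. i \<in> I \<Longrightarrow> (\<lambda>\<xi>. g \<xi> i) \<in> borel_measurable \<mu>"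
  proof
    assume int: "integrable \<mu> (\<lambda>\<xi>. (pow_norm I (g \<xi>))\<^sup>2)"
    show "\<forall>i\<in>I. integrable \<mu> (\<lambda>\<xi>. (norm (g \<xi> i))\<^sup>2)"
    proof
      fix i assume i: "i \<in> I"
      note [measurable] = meas[OF i]
      show "integrable \<mu> (\<lambda>\<xi>. (norm (g \<xi> i))\<^sup>2)"
        by (rule Bochner_Integration.integrable_bound[OF int])
           (use assms i in \<open>auto simp: pow_norm_square sum_nonneg intro!: AE_I2 member_le_sum\<close>)
    qed
  qed (auto simp: pow_norm_square)
  then show ?thesis by (auto simp: L2_fun_def square_integrable_def)
qed

text \<open>
  For finitely many coordinates the squared distance is the sum of the squared distances of the
  coordinates, so convergence may be tested coordinatewise.
\<close>

lemma mem_fourier_iff: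
  fixes \<mu> :: "('g::ab_group_add \<Rightarrow> complex) measure" and f :: "'g \<Rightarrow> 'i \<Rightarrow> 'z::fd_complex_hilbert"
  assumes \<mu>: "haar_probability \<mu>" and I: "finite I"
  shows "g \<in> fourier \<mu> I f \<longleftrightarrow> (\<forall>\<xi>\<in>space \<mu>. g \<xi> \<in> pow_space I) \<and>
    (\<forall>i\<in>I. has_fourier \<mu> (\<lambda>\<gamma>. f \<gamma> i) (\<lambda>\<xi>. g \<xi> i))"
proof (cases "g \<in> L2_fun \<mu> I")
  case False
  then show ?thesis by (auto simp: fourier_def has_fourier_def L2_fun_iff[OF I])
next
  case True
  let ?D = "\<lambda>i A. \<integral>\<xi>. (norm (g \<xi> i - trig_sum A (\<lambda>\<gamma>. f \<gamma> i) \<xi>))\<^sup>2 \<partial>\<mu>"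
  let ?N = "\<lambda>A. L2_norm \<mu> I (\<lambda>\<xi> i. g \<xi> i - fourier_l1 (\<lambda>\<gamma>. if \<gamma> \<in> A then f \<gamma> else (\<lambda>_. 0)) \<xi> i)"
  let ?F = "finite_subsets_at_top (UNIV :: 'g set)"
  have si: "square_integrable \<mu> (\<lambda>\<xi>. g \<xi> i - trig_sum A (\<lambda>\<gamma>. f \<gamma> i) \<xi>)" if "i \<in> I" for i A
    using True that unfolding L2_fun_iff[OF I] by (intro square_integrable_diff trig_sum_parseval \<mu>) auto
  have N: "?N A = sqrt (\<Sum>i\<in>I. ?D i A)" if "finite A" for A
    unfolding L2_norm_def pow_norm_square fourier_l1_truncation[OF that] real_sqrt_eq_iff
    by (rule Bochner_Integration.integral_sum) (use si in \<open>auto simp: square_integrable_def\<close>)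
  have "(?N \<longlongrightarrow> 0) ?F \<longleftrightarrow> ((\<lambda>A. sqrt (\<Sum>i\<in>I. ?D i A)) \<longlongrightarrow> 0) ?F"
    by (rule tendsto_cong) (use N in \<open>auto intro: eventually_mono[OF eventually_finite_subsets_at_top_weakI]\<close>)
  also have "\<dots> \<longleftrightarrow> (\<forall>i\<in>I. (?D i \<longlongrightarrow> 0) ?F)"
  proof
    assume lim: "((\<lambda>A. sqrt (\<Sum>i\<in>I. ?D i A)) \<longlongrightarrow> 0) ?F"
    show "\<forall>i\<in>I. (?D i \<longlongrightarrow> 0) ?F"
    proof
      fix i assume i: "i \<in> I"
      show "(?D i \<longlongrightarrow> 0) ?F"
      proof (rule tendsto_sandwich[where f = "\<lambda>_. 0"])
        show "\<forall>\<^sub>F A in ?F. ?D i A \<le> (sqrt (\<Sum>i\<in>I. ?D i A))\<^sup>2"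
          using I i by (intro always_eventually allI) (auto simp: sum_nonneg intro!: member_le_sum)
        show "((\<lambda>A. (sqrt (\<Sum>i\<in>I. ?D i A))\<^sup>2) \<longlongrightarrow> 0) ?F" using tendsto_power[OF lim, of 2] by simp
      qed auto
    qed
  next
    assume "\<forall>i\<in>I. (?D i \<longlongrightarrow> 0) ?F"
    then have "((\<lambda>A. \<Sum>i\<in>I. ?D i A) \<longlongrightarrow> (\<Sum>i\<in>I. 0)) ?F" by (intro tendsto_sum) auto
    then show "((\<lambda>A. sqrt (\<Sum>i\<in>I. ?D i A)) \<longlongrightarrow> 0) ?F" using tendsto_real_sqrt by fastforce
  qed
  finally show ?thesis using True by (auto simp: fourier_def has_fourier_def L2_fun_iff[OF I])
qed

lemma fourier_nonempty:
  fixes \<mu> :: "('g::ab_group_add \<Rightarrow> complex) measure" and f :: "'g \<Rightarrow> 'i \<Rightarrow> 'z::fd_complex_hilbert"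
  assumes \<mu>: "haar_probability \<mu>" and I: "finite I" and f: "f \<in> l2_group I"
  shows "fourier \<mu> I f \<noteq> {}"
proof -
  have "\<exists>q. has_fourier \<mu> (\<lambda>\<gamma>. f \<gamma> i) q" if "i \<in> I" for i
  proof (rule has_fourier_exists[OF \<mu>])
    show "(\<lambda>\<gamma>. (norm (f \<gamma> i))\<^sup>2) summable_on UNIV"
    proof (rule summable_on_comparison_test)
      show "(\<lambda>\<gamma>. (pow_norm I (f \<gamma>))\<^sup>2) summable_on UNIV" using f by (simp add: l2_group_def)
    qed (use I that in \<open>auto simp: pow_norm_square intro!: member_le_sum\<close>)
  qed
  then obtain q where q: "\<And>i. i \<in> I \<Longrightarrow> has_fourier \<mu> (\<lambda>\<gamma>. f \<gamma> i) (q i)" by metis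
  have "(\<lambda>\<xi> i. if i \<in> I then q i \<xi> else 0) \<in> fourier \<mu> I f"
    using q by (auto simp: mem_fourier_iff[OF \<mu> I] pow_space_def)
  then show ?thesis by blast
qed

lemma fourier_inj_on:
  fixes \<mu> :: "('g::ab_group_add \<Rightarrow> complex) measure"
  assumes \<mu>: "haar_probability \<mu>" and I: "finite I"
  shows "inj_on (fourier \<mu> I :: ('g \<Rightarrow> 'i \<Rightarrow> 'z::fd_complex_hilbert) \<Rightarrow> _) (l2_group I)"
proof (rule inj_onI)
  fix f h :: "'g \<Rightarrow> 'i \<Rightarrow> 'z"
  assume fh: "f \<in> l2_group I" "h \<in> l2_group I" "fourier \<mu> I f = fourier \<mu> I h"
  then obtain g where "g \<in> fourier \<mu> I f" "g \<in> fourier \<mu> I h"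
    using fourier_nonempty[OF \<mu> I fh(1)] by auto
  then have "(\<lambda>\<gamma>. f \<gamma> i) = (\<lambda>\<gamma>. h \<gamma> i)" if "i \<in> I" for i
    using that by (intro has_fourier_injective[OF \<mu>]) (auto simp: mem_fourier_iff[OF \<mu> I])
  moreover have "f \<gamma> i = 0" "h \<gamma> i = 0" if "i \<notin> I" for \<gamma> i
    using fh that by (auto simp: l2_group_def pow_space_def)
  ultimately show "f = h" by (intro ext) (metis (full_types))
qed

lemma fourier_eq_class:
  fixes \<mu> :: "('g::ab_group_add \<Rightarrow> complex) measure" and f :: "'g \<Rightarrow> 'i \<Rightarrow> 'z::fd_complex_hilbert"
  assumes \<mu>: "haar_probability \<mu>" and I: "finite I" and g: "g \<in> fourier \<mu> I f"
  shows "L2_rel \<mu> I `` {g} = fourier \<mu> I f"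
proof (intro equalityI subsetI)
  fix k assume "k \<in> L2_rel \<mu> I `` {g}"
  then have k: "k \<in> L2_fun \<mu> I" "AE \<xi> in \<mu>. g \<xi> = k \<xi>" by (auto simp: L2_rel_def)
  have "has_fourier \<mu> (\<lambda>\<gamma>. f \<gamma> i) (\<lambda>\<xi>. k \<xi> i)" if "i \<in> I" for i
  proof (rule has_fourier_AE_cong[OF \<mu>])
    show "has_fourier \<mu> (\<lambda>\<gamma>. f \<gamma> i) (\<lambda>\<xi>. g \<xi> i)" using g that by (simp add: mem_fourier_iff[OF \<mu> I])
    show "(\<lambda>\<xi>. k \<xi> i) \<in> borel_measurable \<mu>" using k that by (simp add: L2_fun_def)
    show "AE \<xi> in \<mu>. g \<xi> i = k \<xi> i" using k(2) by eventually_elim simp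
  qed
  then show "k \<in> fourier \<mu> I f" using k(1) by (simp add: mem_fourier_iff[OF \<mu> I] L2_fun_def)
next
  fix k assume k: "k \<in> fourier \<mu> I f"
  have "AE \<xi> in \<mu>. \<forall>i\<in>I. g \<xi> i = k \<xi> i"
    using g k by (intro AE_finite_allI I) (auto simp: mem_fourier_iff[OF \<mu> I] intro: has_fourier_unique[OF \<mu>])
  then have "AE \<xi> in \<mu>. g \<xi> = k \<xi>"
  proof (rule AE_mp, intro AE_I2 impI ext)
    fix \<xi> i assume "\<xi> \<in> space \<mu>" "\<forall>i\<in>I. g \<xi> i = k \<xi> i"
    moreover have "g \<xi> \<in> pow_space I" "k \<xi> \<in> pow_space I"
      using g k \<open>\<xi> \<in> space \<mu>\<close> by (auto simp: mem_fourier_iff[OF \<mu> I])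
    ultimately show "g \<xi> i = k \<xi> i" by (cases "i \<in> I") (auto simp: pow_space_def)
  qed
  then show "k \<in> L2_rel \<mu> I `` {g}" using g k by (auto simp: L2_rel_def fourier_def)
qed

section \<open>Coboundary operators in orbit coordinates\<close>

locale gain_framework =
  fixes V :: "'v set" and E :: "'v set set"
    and \<phi> :: "'v \<Rightarrow> 'v \<Rightarrow> 'x::fd_complex_hilbert \<Rightarrow> 'y::fd_complex_hilbert"
    and \<theta> :: "'g::ab_group_add \<Rightarrow> 'v \<Rightarrow> 'v"
    and \<tau> :: "'g \<Rightarrow> 'x \<Rightarrow> 'x"
    and rep :: "'v set \<Rightarrow> 'v"
    and src tgt :: "'v set set \<Rightarrow> 'v set"
    and gain :: "'v set set \<Rightarrow> 'g"
  assumes symmetric: "symmetric_framework V E \<phi> \<theta> \<tau>"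
    and free: "acts_freely V E \<theta>"
    and finite_vertex_orbits: "finite (vertex_orbits V \<theta>)"
    and finite_edge_orbits: "finite (edge_orbits E \<theta>)"
    and gain_graph: "gain_graph V E \<theta> rep src tgt gain"
begin

abbreviation "V0 \<equiv> vertex_orbits V \<theta>"
abbreviation "E0 \<equiv> edge_orbits E \<theta>"
abbreviation "d\<tau> \<gamma> \<equiv> linear_part (\<tau> \<gamma>)"
abbreviation "etilde \<equiv> edge_rep \<theta> rep src tgt gain"
abbreviation "\<phi>_rep a \<equiv> \<phi> (rep (src a)) (\<theta> (gain a) (rep (tgt a)))"

lemma is_framework: "framework V E \<phi>"
  using symmetric by (simp add: symmetric_framework_def)

lemma edge_ends:
  assumes "e \<in> E" shows "\<exists>v\<in>V. \<exists>w\<in>V. e = {v, w}"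
  using assms is_framework by (fastforce simp: framework_def simple_graph_def)

lemma clinear_\<phi>: "v \<in> V \<Longrightarrow> w \<in> V \<Longrightarrow> clinear (\<phi> v w)"
  using is_framework by (simp add: framework_def)

lemma \<theta>_automorphism: "\<theta> \<gamma> \<in> graph_automorphisms V E"
  and \<theta>_add: "v \<in> V \<Longrightarrow> \<theta> (\<gamma> + \<delta>) v = \<theta> \<gamma> (\<theta> \<delta> v)"
  and \<tau>_isometry: "\<tau> \<gamma> \<in> affine_isometries"
  and \<tau>_add: "\<tau> (\<gamma> + \<delta>) = \<tau> \<gamma> \<circ> \<tau> \<delta>"
  and \<phi>_equivariant: "v \<in> V \<Longrightarrow> w \<in> V \<Longrightarrow> \<phi> (\<theta> \<gamma> v) (\<theta> \<gamma> w) x = \<phi> v w (d\<tau> (- \<gamma>) x)"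
  using symmetric by (auto simp: symmetric_framework_def)

lemma \<theta>_bij: "bij_betw (\<theta> \<gamma>) V V"
  using \<theta>_automorphism[of \<gamma>] by (simp add: graph_automorphisms_def)

lemma \<theta>_closed: "v \<in> V \<Longrightarrow> \<theta> \<gamma> v \<in> V"
  using \<theta>_bij bij_betw_apply by fast

lemma \<theta>_zero: "v \<in> V \<Longrightarrow> \<theta> 0 v = v"
  using \<theta>_add[of v 0 0] inj_onD[OF bij_betw_imp_inj_on[OF \<theta>_bij], of 0 "\<theta> 0 v" v] \<theta>_closed by simp

lemma \<theta>_free:
  assumes "v \<in> V" "\<theta> \<gamma> v = \<theta> \<delta> v" shows "\<gamma> = \<delta>"
proof -
  have "\<theta> (- \<delta> + \<gamma>) v = \<theta> (- \<delta> + \<delta>) v" using assms by (simp only: \<theta>_add)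
  then have "\<theta> (- \<delta> + \<gamma>) v = v" using assms(1) by (simp add: \<theta>_zero)
  then have "- \<delta> + \<gamma> = 0" using free assms(1) unfolding acts_freely_def by blast
  then show ?thesis by simp
qed

lemma clinear_d\<tau>: "clinear (d\<tau> \<gamma>)"
  using \<tau>_isometry by (simp add: affine_isometries_def)

lemma norm_d\<tau>: "norm (d\<tau> \<gamma> x) = norm x"
proof -
  have "dist (\<tau> \<gamma> x) (\<tau> \<gamma> 0) = dist x 0" using \<tau>_isometry by (simp add: affine_isometries_def)
  then show ?thesis by (simp add: linear_part_def dist_norm)
qed

lemma d\<tau>_add: "d\<tau> (\<gamma> + \<delta>) x = d\<tau> \<gamma> (d\<tau> \<delta> x)"
proof -
  have "d\<tau> \<gamma> (\<tau> \<delta> x - \<tau> \<delta> 0) = d\<tau> \<gamma> (\<tau> \<delta> x) - d\<tau> \<gamma> (\<tau> \<delta> 0)" by (rule clinear_diff[OF clinear_d\<tau>])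
  then show ?thesis by (simp add: linear_part_def \<tau>_add)
qed

lemma rep_closed: "p \<in> V0 \<Longrightarrow> rep p \<in> V"
  using gain_graph \<theta>_closed unfolding gain_graph_def vertex_orbits_def by fastforce

lemma
  assumes "a \<in> E0"
  shows src_closed: "src a \<in> V0" and tgt_closed: "tgt a \<in> V0" and etilde_in_orbit: "etilde a \<in> a"
    and src_rep_closed: "rep (src a) \<in> V" and tgt_rep_closed: "rep (tgt a) \<in> V"
  using assms gain_graph rep_closed by (auto simp: gain_graph_def)

lemma edge_image:
  assumes "e \<in> E" shows "\<theta> \<gamma> ` e \<in> E"
proof -
  obtain v w where "v \<in> V" "w \<in> V" "e = {v, w}" using edge_ends[OF assms] by blast
  then show ?thesis using \<theta>_automorphism[of \<gamma>] assms by (simp add: graph_automorphisms_def)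
qed

text \<open>
  The representative of the orbit of \<open>e\<close> is itself a translate of \<open>e\<close>, and translations are
  invertible. Both the norm bound and the injectivity of \<open>S_E\<close> rest on this.
\<close>

lemma edge_translate_exists:
  assumes e: "e \<in> E" shows "\<exists>\<gamma>. \<exists>a\<in>E0. e = \<theta> \<gamma> ` etilde a"
proof -
  define a where "a = range (\<lambda>\<gamma>. \<theta> \<gamma> ` e)"
  have a: "a \<in> E0" using e by (auto simp: a_def edge_orbits_def)
  then obtain \<delta> where \<delta>: "etilde a = \<theta> \<delta> ` e" using etilde_in_orbit unfolding a_def by blast
  have "e \<subseteq> V" using edge_ends[OF e] by auto
  then have "\<theta> (- \<delta>) (\<theta> \<delta> v) = v" if "v \<in> e" for v
    using that \<theta>_zero[of v] by (simp flip: \<theta>_add add: subset_iff)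
  then have "\<theta> (- \<delta>) ` \<theta> \<delta> ` e = e" by (simp add: image_image)
  then show ?thesis using a \<delta> by metis
qed

lemma edge_translate_in:
  assumes "a \<in> E0" shows "\<theta> \<gamma> ` etilde a \<in> E"
proof -
  have "etilde a \<in> E"
    using etilde_in_orbit[OF assms] assms edge_image by (auto simp: edge_orbits_def)
  then show ?thesis by (rule edge_image)
qed

lemma coboundary_translate:
  assumes a: "a \<in> E0"
  shows "coboundary E \<phi> z (\<theta> \<gamma> ` etilde a) =
    \<phi>_rep a (d\<tau> (- \<gamma>) (z (\<theta> \<gamma> (rep (src a))) - z (\<theta> (\<gamma> + gain a) (rep (tgt a)))))"
proof -
  let ?s = "rep (src a)" and ?t = "\<theta> (gain a) (rep (tgt a))"
  have V: "?s \<in> V" "?t \<in> V" using a src_rep_closed tgt_rep_closed \<theta>_closed by auto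
  have im: "\<theta> \<gamma> ` etilde a = {\<theta> \<gamma> ?s, \<theta> \<gamma> ?t}" by (simp add: edge_rep_def)
  have E: "{\<theta> \<gamma> ?s, \<theta> \<gamma> ?t} \<in> E" using edge_translate_in[OF a] im by metis
  have "coboundary E \<phi> z (\<theta> \<gamma> ` etilde a) = \<phi> (\<theta> \<gamma> ?s) (\<theta> \<gamma> ?t) (z (\<theta> \<gamma> ?s) - z (\<theta> \<gamma> ?t))"
    unfolding im by (rule coboundary_edge[OF is_framework \<theta>_closed[OF V(1)] \<theta>_closed[OF V(2)] E])
  then show ?thesis using V a by (simp add: \<phi>_equivariant \<theta>_add tgt_rep_closed)
qed

lemma coboundary_add: "coboundary E \<phi> (\<lambda>v. z v + z' v) e = coboundary E \<phi> z e + coboundary E \<phi> z' e"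
  and coboundary_scaleC: "coboundary E \<phi> (\<lambda>v. c *\<^sub>C z v) e = c *\<^sub>C coboundary E \<phi> z e"
proof -
  have "coboundary E \<phi> (\<lambda>v. z v + z' v) e = coboundary E \<phi> z e + coboundary E \<phi> z' e \<and>
    coboundary E \<phi> (\<lambda>v. c *\<^sub>C z v) e = c *\<^sub>C coboundary E \<phi> z e"
  proof (cases "e \<in> E")
    case True
    then obtain v w where vw: "v \<in> V" "w \<in> V" "e = {v, w}" using edge_ends by blast
    have *: "coboundary E \<phi> z e = \<phi> v w (z v - z w)" for z
      unfolding vw(3) by (rule coboundary_edge[OF is_framework vw(1,2)]) (use True vw in simp)
    show ?thesis
      using clinear_add[OF clinear_\<phi>[OF vw(1,2)], of "z v - z w" "z' v - z' w"]
        clinear_scaleC[OF clinear_\<phi>[OF vw(1,2)], of c "z v - z w"]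
      by (simp add: * scaleC_diff_right algebra_simps)
  qed (simp add: coboundary_def scaleC_zero_right)
  then show "coboundary E \<phi> (\<lambda>v. z v + z' v) e = coboundary E \<phi> z e + coboundary E \<phi> z' e"
    "coboundary E \<phi> (\<lambda>v. c *\<^sub>C z v) e = c *\<^sub>C coboundary E \<phi> z e" by auto
qed

text \<open>
  As the action is free, the sum meets each vertex at most once. The shift \<open>s\<close> accommodates the gains.
\<close>

lemma orbit_sum_le:
  fixes z :: "'v \<Rightarrow> 'x"
  assumes z: "z \<in> l2 V" and v: "v \<in> V" and G: "finite G"
  shows "(\<Sum>\<gamma>\<in>G. (norm (z (\<theta> (\<gamma> + s) v)))\<^sup>2) \<le> (l2_norm V z)\<^sup>2"
proof -
  have inj: "inj_on (\<lambda>\<gamma>. \<theta> (\<gamma> + s) v) G"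
  proof (rule inj_onI)
    fix \<gamma> \<delta> assume "\<theta> (\<gamma> + s) v = \<theta> (\<delta> + s) v"
    from \<theta>_free[OF v this] show "\<gamma> = \<delta>" by simp
  qed
  have "(\<Sum>\<gamma>\<in>G. (norm (z (\<theta> (\<gamma> + s) v)))\<^sup>2) = (\<Sum>w\<in>(\<lambda>\<gamma>. \<theta> (\<gamma> + s) v) ` G. (norm (z w))\<^sup>2)"
    by (simp add: sum.reindex[OF inj])
  also have "\<dots> \<le> (\<Sum>\<^sub>\<infinity>w\<in>V. (norm (z w))\<^sup>2)"
    using z v G \<theta>_closed by (intro finite_sum_le_infsum) (auto simp: l2_def)
  also have "\<dots> = (l2_norm V z)\<^sup>2" by (simp add: l2_norm_def infsum_nonneg)
  finally show ?thesis .
qed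

lemma ex_uniform_bound:
  obtains K where "K \<ge> 0" "\<And>a x. a \<in> E0 \<Longrightarrow> norm (\<phi>_rep a x) \<le> K * norm x"
proof -
  have "\<exists>K\<ge>0. \<forall>x. norm (\<phi>_rep a x) \<le> norm x * K" if "a \<in> E0" for a
    using bounded_linear.nonneg_bounded[OF clinear_imp_bounded_linear[OF clinear_\<phi>]]
      src_rep_closed[OF that] \<theta>_closed[OF tgt_rep_closed[OF that]] by blast
  then obtain k where k: "\<And>a. a \<in> E0 \<Longrightarrow> k a \<ge> 0" "\<And>a x. a \<in> E0 \<Longrightarrow> norm (\<phi>_rep a x) \<le> norm x * k a"
    by metis
  have bound: "norm (\<phi>_rep a x) \<le> (\<Sum>a\<in>E0. k a) * norm x" if "a \<in> E0" for a x
  proof -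
    have "k a \<le> (\<Sum>a\<in>E0. k a)" using that k(1) finite_edge_orbits by (intro member_le_sum) auto
    then have "norm x * k a \<le> norm x * (\<Sum>a\<in>E0. k a)" by (intro mult_left_mono) auto
    then show ?thesis using k(2)[OF that, of x] by (simp add: mult.commute)
  qed
  show thesis by (rule that[OF sum_nonneg[OF k(1)] bound])
qed

text \<open>
  The bound is stated for finite sums, so that it gives both membership in the \<open>\<ell>\<^sup>2\<close> spaces and the
  operator norm estimate, over the edges as well as over the group.
\<close>

lemma coboundary_translates_bound:
  obtains K where "K \<ge> 0" "\<And>z G. z \<in> l2 V \<Longrightarrow> finite G \<Longrightarrow>
     (\<Sum>\<gamma>\<in>G. \<Sum>a\<in>E0. (norm (coboundary E \<phi> z (\<theta> \<gamma> ` etilde a)))\<^sup>2) \<le> K * (l2_norm V z)\<^sup>2"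
proof -
  obtain K where K: "K \<ge> 0" "\<And>a x. a \<in> E0 \<Longrightarrow> norm (\<phi>_rep a x) \<le> K * norm x"
    by (rule ex_uniform_bound[OF that])
  have bound: "(\<Sum>\<gamma>\<in>G. \<Sum>a\<in>E0. (norm (coboundary E \<phi> z (\<theta> \<gamma> ` etilde a)))\<^sup>2)
      \<le> real (card E0) * (4 * K\<^sup>2) * (l2_norm V z)\<^sup>2" if z: "z \<in> l2 V" and G: "finite G" for z G
  proof -
    have "(\<Sum>\<gamma>\<in>G. (norm (coboundary E \<phi> z (\<theta> \<gamma> ` etilde a)))\<^sup>2) \<le> 4 * K\<^sup>2 * (l2_norm V z)\<^sup>2"
      if a: "a \<in> E0" for a
    proof -
      let ?s = "rep (src a)" and ?t = "rep (tgt a)"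
      have "(norm (coboundary E \<phi> z (\<theta> \<gamma> ` etilde a)))\<^sup>2
          \<le> K\<^sup>2 * (2 * (norm (z (\<theta> (\<gamma> + 0) ?s)))\<^sup>2 + 2 * (norm (z (\<theta> (\<gamma> + gain a) ?t)))\<^sup>2)" for \<gamma>
      proof -
        have "(norm (coboundary E \<phi> z (\<theta> \<gamma> ` etilde a)))\<^sup>2
            \<le> (K * norm (z (\<theta> \<gamma> ?s) - z (\<theta> (\<gamma> + gain a) ?t)))\<^sup>2"
          unfolding coboundary_translate[OF a]
          using K(2)[OF a] norm_d\<tau> by (intro power_mono) (metis, simp)
        also have "\<dots> \<le> K\<^sup>2 * (2 * (norm (z (\<theta> \<gamma> ?s)))\<^sup>2 + 2 * (norm (z (\<theta> (\<gamma> + gain a) ?t)))\<^sup>2)"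
          unfolding power_mult_distrib by (intro mult_left_mono norm_diff_square_le) simp
        finally show ?thesis by simp
      qed
      then have "(\<Sum>\<gamma>\<in>G. (norm (coboundary E \<phi> z (\<theta> \<gamma> ` etilde a)))\<^sup>2)
          \<le> K\<^sup>2 * (2 * (\<Sum>\<gamma>\<in>G. (norm (z (\<theta> (\<gamma> + 0) ?s)))\<^sup>2) +
                   2 * (\<Sum>\<gamma>\<in>G. (norm (z (\<theta> (\<gamma> + gain a) ?t)))\<^sup>2))"
        unfolding sum_distrib_left sum.distrib[symmetric] by (intro sum_mono)
      also have "\<dots> \<le> K\<^sup>2 * (2 * (l2_norm V z)\<^sup>2 + 2 * (l2_norm V z)\<^sup>2)"
        by (intro mult_left_mono add_mono orbit_sum_le z G src_rep_closed tgt_rep_closed a) auto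
      finally show ?thesis by simp
    qed
    then have "(\<Sum>a\<in>E0. \<Sum>\<gamma>\<in>G. (norm (coboundary E \<phi> z (\<theta> \<gamma> ` etilde a)))\<^sup>2)
        \<le> (\<Sum>a\<in>E0. 4 * K\<^sup>2 * (l2_norm V z)\<^sup>2)" by (intro sum_mono)
    then show ?thesis by (subst sum.swap) (simp add: mult.assoc)
  qed
  show thesis by (rule that[OF _ bound]) simp
qed

lemma coboundary_bounded: "bounded_l2_operator V E (coboundary E \<phi>)"
proof -
  obtain K where K: "K \<ge> 0" "\<And>z G. z \<in> l2 V \<Longrightarrow> finite G \<Longrightarrow>
     (\<Sum>\<gamma>\<in>G. \<Sum>a\<in>E0. (norm (coboundary E \<phi> z (\<theta> \<gamma> ` etilde a)))\<^sup>2) \<le> K * (l2_norm V z)\<^sup>2"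
    by (rule coboundary_translates_bound[OF that])
  obtain c where c: "\<And>e. e \<in> E \<Longrightarrow> \<exists>a\<in>E0. e = \<theta> (c e) ` etilde a" using edge_translate_exists by metis
  have finite_bound: "(\<Sum>e\<in>F. (norm (coboundary E \<phi> z e))\<^sup>2) \<le> K * (l2_norm V z)\<^sup>2"
    if z: "z \<in> l2 V" and F: "finite F" "F \<subseteq> E" for z F
  proof -
    let ?m = "\<lambda>(\<gamma>, a). \<theta> \<gamma> ` etilde a"
    have "F \<subseteq> ?m ` (c ` F \<times> E0)"
    proof
      fix e assume e: "e \<in> F"
      then obtain a where "a \<in> E0" "e = \<theta> (c e) ` etilde a" using F(2) c by blast
      then show "e \<in> ?m ` (c ` F \<times> E0)" using e by (intro image_eqI[of _ _ "(c e, a)"]) auto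
    qed
    then have "(\<Sum>e\<in>F. (norm (coboundary E \<phi> z e))\<^sup>2) \<le> (\<Sum>e\<in>?m ` (c ` F \<times> E0). (norm (coboundary E \<phi> z e))\<^sup>2)"
      using F(1) finite_edge_orbits by (intro sum_mono2) auto
    also have "\<dots> \<le> (\<Sum>x\<in>c ` F \<times> E0. (norm (coboundary E \<phi> z (?m x)))\<^sup>2)"
      using F(1) finite_edge_orbits sum_image_le[of "c ` F \<times> E0" "\<lambda>e. (norm (coboundary E \<phi> z e))\<^sup>2" ?m]
      by (simp add: comp_def)
    also have "\<dots> = (\<Sum>\<gamma>\<in>c ` F. \<Sum>a\<in>E0. (norm (coboundary E \<phi> z (\<theta> \<gamma> ` etilde a)))\<^sup>2)"
      by (simp add: sum.cartesian_product split_def)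
    also have "\<dots> \<le> K * (l2_norm V z)\<^sup>2" by (intro K(2) z finite_imageI F(1))
    finally show ?thesis .
  qed
  have summable: "(\<lambda>e. (norm (coboundary E \<phi> z e))\<^sup>2) summable_on E" if "z \<in> l2 V" for z
    by (rule nonneg_bounded_partial_sums_imp_summable_on[where C = "K * (l2_norm V z)\<^sup>2"])
       (use finite_bound[OF that] in \<open>auto intro: eventually_finite_subsets_at_top_weakI\<close>)
  have "l2_norm E (coboundary E \<phi> z) \<le> sqrt K * l2_norm V z" if "z \<in> l2 V" for z
  proof -
    have "(\<Sum>\<^sub>\<infinity>e\<in>E. (norm (coboundary E \<phi> z e))\<^sup>2) \<le> K * (l2_norm V z)\<^sup>2"
      by (rule infsum_le_finite_sums[OF summable[OF that] finite_bound[OF that]])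
    then have "l2_norm E (coboundary E \<phi> z) \<le> sqrt (K * (l2_norm V z)\<^sup>2)"
      unfolding l2_norm_def[of E] by (rule real_sqrt_le_mono)
    then show ?thesis by (simp add: real_sqrt_mult l2_norm_def infsum_nonneg)
  qed
  moreover have "coboundary E \<phi> z \<in> l2 E" if "z \<in> l2 V" for z
    using summable[OF that] by (simp add: l2_def coboundary_def)
  ultimately show ?thesis
    unfolding bounded_l2_operator_def using coboundary_add coboundary_scaleC by blast
qed

lemma S_E_inj_on: "inj_on (S_E E \<theta> rep src tgt gain :: ('v set \<Rightarrow> 'z::fd_complex_hilbert) \<Rightarrow> _) (l2 E)"
proof (rule inj_onI)
  fix y z :: "'v set \<Rightarrow> 'z"
  assume yz: "y \<in> l2 E" "z \<in> l2 E" "S_E E \<theta> rep src tgt gain y = S_E E \<theta> rep src tgt gain z"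
  show "y = z"
  proof
    fix e
    show "y e = z e"
    proof (cases "e \<in> E")
      case True
      then obtain \<gamma> a where "a \<in> E0" "e = \<theta> \<gamma> ` etilde a" using edge_translate_exists by blast
      then show ?thesis using fun_cong[OF fun_cong[OF yz(3), of \<gamma>], of a] by (simp add: S_E_def)
    qed (use yz in \<open>auto simp: l2_def\<close>)
  qed
qed

lemma S_E_coboundary_in_l2_group:
  assumes z: "z \<in> l2 V"
  shows "S_E E \<theta> rep src tgt gain (coboundary E \<phi> z) \<in> l2_group E0"
proof -
  obtain K where "K \<ge> 0" and K: "\<And>z G. z \<in> l2 V \<Longrightarrow> finite G \<Longrightarrow>
     (\<Sum>\<gamma>\<in>G. \<Sum>a\<in>E0. (norm (coboundary E \<phi> z (\<theta> \<gamma> ` etilde a)))\<^sup>2) \<le> K * (l2_norm V z)\<^sup>2"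
    by (rule coboundary_translates_bound[OF that])
  have "(\<lambda>\<gamma>. \<Sum>a\<in>E0. (norm (coboundary E \<phi> z (\<theta> \<gamma> ` etilde a)))\<^sup>2) summable_on UNIV"
    by (rule nonneg_bounded_partial_sums_imp_summable_on[where C = "K * (l2_norm V z)\<^sup>2"])
       (use K[OF z] in \<open>auto intro: eventually_finite_subsets_at_top_weakI sum_nonneg\<close>)
  then show ?thesis by (simp add: l2_group_def pow_norm_square S_E_def pow_space_def)
qed

lemma T_S_V_apply:
  "p \<in> V0 \<Longrightarrow> T_op \<tau> (S_V V \<theta> rep z) \<gamma> p = d\<tau> (- \<gamma>) (z (\<theta> \<gamma> (rep p)))"
  by (simp add: T_op_def tau_tilde_def S_V_def)

lemma T_S_V_in_l2_group:
  assumes z: "z \<in> l2 V"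
  shows "T_op \<tau> (S_V V \<theta> rep z) \<in> l2_group V0"
proof -
  have "(\<Sum>\<gamma>\<in>G. \<Sum>p\<in>V0. (norm (z (\<theta> \<gamma> (rep p))))\<^sup>2) \<le> real (card V0) * (l2_norm V z)\<^sup>2"
    if G: "finite G" for G
  proof -
    have "(\<Sum>\<gamma>\<in>G. (norm (z (\<theta> \<gamma> (rep p))))\<^sup>2) \<le> (l2_norm V z)\<^sup>2" if "p \<in> V0" for p
      using orbit_sum_le[OF z rep_closed[OF that] G, of 0] by simp
    then have "(\<Sum>p\<in>V0. \<Sum>\<gamma>\<in>G. (norm (z (\<theta> \<gamma> (rep p))))\<^sup>2) \<le> real (card V0) * (l2_norm V z)\<^sup>2"
      by (rule sum_bounded_above)
    then show ?thesis by (subst sum.swap)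
  qed
  then have "(\<lambda>\<gamma>. \<Sum>p\<in>V0. (norm (z (\<theta> \<gamma> (rep p))))\<^sup>2) summable_on UNIV"
    by (intro nonneg_bounded_partial_sums_imp_summable_on[where C = "real (card V0) * (l2_norm V z)\<^sup>2"])
       (auto intro: eventually_finite_subsets_at_top_weakI sum_nonneg)
  moreover have "T_op \<tau> (S_V V \<theta> rep z) \<gamma> p = 0" if "p \<notin> V0" for \<gamma> p
    using that clinear_zero[OF clinear_d\<tau>] by (simp add: T_op_def tau_tilde_def S_V_def)
  ultimately show ?thesis
    by (simp add: l2_group_def pow_norm_square pow_space_def T_S_V_apply norm_d\<tau>)
qed

text \<open>
  The twist turns the coefficients, which vary with \<open>\<gamma>\<close>, into constants: since
  \<open>-\<gamma> = g - (\<gamma> + g)\<close>, the map \<open>d\<tau>(-\<gamma>)\<close> at the head of the edge factors as \<open>d\<tau>(g)\<close> after the twist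
  at \<open>\<gamma> + g\<close>.
\<close>

lemma coboundary_convolution:
  assumes a: "a \<in> E0"
  shows "S_E E \<theta> rep src tgt gain (coboundary E \<phi> z) \<gamma> a =
    \<phi>_rep a (T_op \<tau> (S_V V \<theta> rep z) \<gamma> (src a)) -
    \<phi>_rep a (d\<tau> (gain a) (T_op \<tau> (S_V V \<theta> rep z) (\<gamma> + gain a) (tgt a)))"
proof -
  have "d\<tau> (gain a) (d\<tau> (- (\<gamma> + gain a)) x) = d\<tau> (- \<gamma>) x" for x
    by (simp flip: d\<tau>_add)
  then show ?thesis
    using a src_closed[OF a] tgt_closed[OF a] src_rep_closed[OF a] \<theta>_closed[OF tgt_rep_closed[OF a]]
    by (simp add: S_E_def coboundary_translate T_S_V_apply
        clinear_diff[OF clinear_\<phi>] clinear_diff[OF clinear_d\<tau>])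
qed

definition symbol :: "('g \<Rightarrow> complex) \<Rightarrow> ('v set \<Rightarrow> 'x) \<Rightarrow> 'v set set \<Rightarrow> 'y" where
  "symbol \<xi> x = (\<lambda>a. if a \<in> E0
     then \<phi>_rep a (x (src a)) - \<xi> (gain a) *\<^sub>C \<phi>_rep a (d\<tau> (gain a) (x (tgt a))) else 0)"

lemma clinear_\<phi>_rep:
  assumes "a \<in> E0"
  shows "clinear (\<phi>_rep a)" and "clinear (\<lambda>x. \<phi>_rep a (d\<tau> (gain a) x))"
proof -
  show *: "clinear (\<phi>_rep a)"
    by (intro clinear_\<phi> \<theta>_closed src_rep_closed tgt_rep_closed assms)
  show "clinear (\<lambda>x. \<phi>_rep a (d\<tau> (gain a) x))"
    using * clinear_d\<tau>[of "gain a"] by (simp add: clinear_def)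
qed

lemma symbol_in_Linf_op:
  fixes \<mu> :: "('g \<Rightarrow> complex) measure"
  assumes \<mu>: "haar_probability \<mu>"
  shows "symbol \<in> Linf_op \<mu> V0 E0"
proof -
  obtain K where K: "K \<ge> 0" "\<And>a x. a \<in> E0 \<Longrightarrow> norm (\<phi>_rep a x) \<le> K * norm x"
    by (rule ex_uniform_bound[OF that])
  have "pow_linear V0 E0 (symbol \<xi>)" for \<xi>
    unfolding pow_linear_def
    by (auto simp: symbol_def pow_space_def fun_eq_iff clinear_add[OF clinear_\<phi>_rep(1)]
        clinear_add[OF clinear_\<phi>_rep(2)] clinear_scaleC[OF clinear_\<phi>_rep(1)]
        clinear_scaleC[OF clinear_\<phi>_rep(2)] scaleC_add_right scaleC_diff_right scaleC_scaleC
        scaleC_zero_right mult.commute)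
  moreover have "(\<lambda>\<xi>. symbol \<xi> x a) \<in> borel_measurable \<mu>" for x a
  proof -
    note [measurable] = measurable_evaluation[OF \<mu>]
    show ?thesis unfolding symbol_def by (cases "a \<in> E0") (simp, measurable)
  qed
  moreover have "pow_norm E0 (symbol \<xi> x) \<le> (real (card E0) * (2 * K)) * pow_norm V0 x"
    if "\<xi> \<in> space \<mu>" for \<xi> x
  proof -
    have \<xi>: "\<xi> \<in> dual_group" using that haar_space[OF \<mu>] by simp
    have x: "norm (x p) \<le> pow_norm V0 x" if "p \<in> V0" for p
      unfolding pow_norm_def
      using member_le_L2_set[OF finite_vertex_orbits that, of "\<lambda>p. norm (x p)"] by simp
    have "norm (symbol \<xi> x a) \<le> 2 * K * pow_norm V0 x" if a: "a \<in> E0" for a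
    proof -
      have "norm (symbol \<xi> x a) \<le> norm (\<phi>_rep a (x (src a))) + norm (\<phi>_rep a (d\<tau> (gain a) (x (tgt a))))"
        using a norm_triangle_ineq4[of "\<phi>_rep a (x (src a))" "\<xi> (gain a) *\<^sub>C \<phi>_rep a (d\<tau> (gain a) (x (tgt a)))"]
        by (simp add: symbol_def norm_scaleC dual_groupD(2)[OF \<xi>])
      also have "\<dots> \<le> K * norm (x (src a)) + K * norm (x (tgt a))"
        using K(2)[OF a] norm_d\<tau> by (intro add_mono) metis+
      also have "\<dots> \<le> K * pow_norm V0 x + K * pow_norm V0 x"
        by (intro add_mono mult_left_mono x K(1) src_closed tgt_closed a)
      finally show ?thesis by simp
    qed
    then have "(\<Sum>a\<in>E0. norm (symbol \<xi> x a)) \<le> real (card E0) * (2 * K * pow_norm V0 x)"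
      by (rule sum_bounded_above)
    moreover have "pow_norm E0 (symbol \<xi> x) \<le> (\<Sum>a\<in>E0. norm (symbol \<xi> x a))"
      unfolding pow_norm_def by (rule L2_set_le_sum) simp
    ultimately show ?thesis by (simp add: mult.assoc)
  qed
  then have "AE \<xi> in \<mu>. \<forall>x\<in>pow_space V0. pow_norm E0 (symbol \<xi> x) \<le> (real (card E0) * (2 * K)) * pow_norm V0 x"
    by (intro AE_I2) blast
  ultimately show ?thesis unfolding Linf_op_def by blast
qed

text \<open>
  In each coordinate the symbol combines a linear map of the transform with a character multiple of
  another; these are the transforms of the two terms of \<open>coboundary_convolution\<close>.
\<close>

lemma symbol_mult_fourier:
  fixes \<mu> :: "('g \<Rightarrow> complex) measure"
  assumes \<mu>: "haar_probability \<mu>"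
    and g: "g \<in> fourier \<mu> V0 (T_op \<tau> (S_V V \<theta> rep z))"
  shows "(\<lambda>\<xi>. symbol \<xi> (g \<xi>)) \<in> fourier \<mu> E0 (S_E E \<theta> rep src tgt gain (coboundary E \<phi> z))"
  unfolding mem_fourier_iff[OF \<mu> finite_edge_orbits]
proof (intro conjI ballI)
  show "symbol \<xi> (g \<xi>) \<in> pow_space E0" for \<xi> by (simp add: symbol_def pow_space_def)
  fix a assume a: "a \<in> E0"
  let ?f = "T_op \<tau> (S_V V \<theta> rep z)"
  have f: "has_fourier \<mu> (\<lambda>\<gamma>. ?f \<gamma> p) (\<lambda>\<xi>. g \<xi> p)" if "p \<in> V0" for p
    using g that by (simp add: mem_fourier_iff[OF \<mu> finite_vertex_orbits])
  have "has_fourier \<mu> (\<lambda>\<gamma>. \<phi>_rep a (?f \<gamma> (src a)) - \<phi>_rep a (d\<tau> (gain a) (?f (\<gamma> + gain a) (tgt a))))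
     (\<lambda>\<xi>. \<phi>_rep a (g \<xi> (src a)) - \<xi> (gain a) *\<^sub>C \<phi>_rep a (d\<tau> (gain a) (g \<xi> (tgt a))))"
    by (rule has_fourier_diff[OF \<mu> has_fourier_clinear[OF \<mu> clinear_\<phi>_rep(1)[OF a] f[OF src_closed[OF a]]]
          has_fourier_translate[OF \<mu> has_fourier_clinear[OF \<mu> clinear_\<phi>_rep(2)[OF a] f[OF tgt_closed[OF a]]]]])
  then show "has_fourier \<mu> (\<lambda>\<gamma>. S_E E \<theta> rep src tgt gain (coboundary E \<phi> z) \<gamma> a) (\<lambda>\<xi>. symbol \<xi> (g \<xi>) a)"
    unfolding coboundary_convolution[OF a] using a by (simp add: symbol_def)
qed

text \<open>
  Every representative of the transform of \<open>z\<close> is sent to the same class. Since at least one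
  representative exists, the union in \<open>mult_op\<close> is that class, and injectivity undoes the last two maps.
\<close>

lemma coboundary_factorisation:
  fixes \<mu> :: "('g \<Rightarrow> complex) measure"
  assumes \<mu>: "haar_probability \<mu>" and z: "z \<in> l2 V"
  shows "coboundary E \<phi> z =
    inv_into (l2 E) (S_E E \<theta> rep src tgt gain)
      (inv_into (l2_group E0) (fourier \<mu> E0)
        (mult_op \<mu> E0 symbol (fourier \<mu> V0 (T_op \<tau> (S_V V \<theta> rep z)))))"
proof -
  let ?F = "fourier \<mu> V0 (T_op \<tau> (S_V V \<theta> rep z))"
  let ?h = "S_E E \<theta> rep src tgt gain (coboundary E \<phi> z)"
  have "mult_op \<mu> E0 symbol ?F = (\<Union>g\<in>?F. fourier \<mu> E0 ?h)"
    unfolding mult_op_def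
    by (intro SUP_cong refl fourier_eq_class[OF \<mu> finite_edge_orbits] symbol_mult_fourier[OF \<mu>])
  also have "\<dots> = fourier \<mu> E0 ?h"
    using fourier_nonempty[OF \<mu> finite_vertex_orbits T_S_V_in_l2_group[OF z]] by simp
  finally have "inv_into (l2_group E0) (fourier \<mu> E0) (mult_op \<mu> E0 symbol ?F) = ?h"
    by (simp add: inv_into_f_f[OF fourier_inj_on[OF \<mu> finite_edge_orbits] S_E_coboundary_in_l2_group[OF z]])
  moreover have "coboundary E \<phi> z \<in> l2 E"
    using coboundary_bounded z by (simp add: bounded_l2_operator_def)
  ultimately show ?thesis by (simp add: inv_into_f_f[OF S_E_inj_on])
qed

end

section \<open>The factorisation\<close>

theorem theorem3p6:
  fixes V :: "'v set" and E :: "'v set set"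
    and \<phi> :: "'v \<Rightarrow> 'v \<Rightarrow> 'x::fd_complex_hilbert \<Rightarrow> 'y::fd_complex_hilbert"
    and \<theta> :: "'g::ab_group_add \<Rightarrow> 'v \<Rightarrow> 'v"
    and \<tau> :: "'g \<Rightarrow> 'x \<Rightarrow> 'x"
    and \<mu> :: "('g \<Rightarrow> complex) measure"
    and rep :: "'v set \<Rightarrow> 'v"
    and src tgt :: "'v set set \<Rightarrow> 'v set"
    and gain :: "'v set set \<Rightarrow> 'g"
  assumes "countable V"
    and "symmetric_framework V E \<phi> \<theta> \<tau>"
    and "acts_freely V E \<theta>"
    and "finite (vertex_orbits V \<theta>)"
    and "finite (edge_orbits E \<theta>)"
    and "gain_graph V E \<theta> rep src tgt gain"
    and "haar_probability \<mu>"
  shows "bounded_l2_operator V E (coboundary E \<phi>) \<and>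
    (\<exists>\<Phi> \<in> Linf_op \<mu> (vertex_orbits V \<theta>) (edge_orbits E \<theta>).
       \<forall>z \<in> l2 V.
         coboundary E \<phi> z =
           (inv_into (l2 E) (S_E E \<theta> rep src tgt gain)
            \<circ> inv_into (l2_group (edge_orbits E \<theta>)) (fourier \<mu> (edge_orbits E \<theta>))
            \<circ> mult_op \<mu> (edge_orbits E \<theta>) \<Phi>
            \<circ> fourier \<mu> (vertex_orbits V \<theta>)
            \<circ> T_op \<tau>
            \<circ> S_V V \<theta> rep) z)"
proof -
  interpret gain_framework V E \<phi> \<theta> \<tau> rep src tgt gain
    using assms by unfold_locales
  show ?thesis
    using coboundary_bounded symbol_in_Linf_op[OF assms(7)] coboundary_factorisation[OF assms(7)]
    by (intro conjI bexI[of _ symbol]) auto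
qed

end
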